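(* Let $\mathcal{H}$ be a complex Hilbert space, let $S_j,T_j\in\mathbb{B}(\mathcal{H})$ for $j=1,\ldots,n$, and let $f:[0,\infty)\to[0,\infty)$ be a strictly increasing operator convex function such that $f(0)=0$. Then $$\begin{aligned} \omega_f(T_1^*S_1,\ldots,T_n^*S_n) &\le f^{-1}\left(\left\|\int_0^1\left(\sum_{j=1}^n f\left(t|S_j|^2+(1-t)|T_j|^2\right)\right)dt\right\|\right)\\ &\le f^{-1}\left(\frac12\left\|\sum_{j=1}^n\left(f\left(|S_j|^2\right)+f\left(|T_j|^2\right)\right)\right\|\right). \end{aligned}$$
   Context: $\mathbb{B}(\mathcal{H})$ is the $C^*$-algebra of all bounded linear operators on $\mathcal{H}$, and $\|\cdot\|$ is the operator norm. $|T|=(T^*T)^{1/2}$, and for a positive operator $A$ the operator $f(A)$ is given by the continuous functional calculus. A function $f:[0,\infty)\to\mathbb{R}$ is operator convex if $f((1-t)A+tB)\le(1-t)f(A)+tf(B)$ (in the order of self-adjoint operators) for all positive operators $A,B$ and all $t\in[0,1]$. For a strictly increasing convex function $f$ with $f(0)=0$, the $f$-operator radius of $X_1,\ldots,X_n\in\mathbb{B}(\mathcal{H})$ is $$\omega_f(X_1,\ldots,X_n)=\sup_{\|x\|=1}f^{-1}\left(\sum_{i=1}^n f\left(|\langle X_ix,x\rangle|\right)\right).$$ *)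

theory Defs
  imports "HOL-Analysis.Analysis" "HOL-Computational_Algebra.Polynomial"
begin

(* Complex Hilbert spaces. The inner product is linear in the first argument.
   The real structure, the norm and completeness come from banach. *)

class chilbert_space = banach +
  fixes scaleC :: "complex \<Rightarrow> 'a \<Rightarrow> 'a"  (infixr \<open>*\<^sub>C\<close> 75)
    and cinner :: "'a \<Rightarrow> 'a \<Rightarrow> complex"
  assumes scaleC_add_right: "a *\<^sub>C (x + y) = a *\<^sub>C x + a *\<^sub>C y"
    and scaleC_add_left: "(a + b) *\<^sub>C x = a *\<^sub>C x + b *\<^sub>C x"
    and scaleC_scaleC: "a *\<^sub>C b *\<^sub>C x = (a * b) *\<^sub>C x"
    and scaleR_scaleC: "r *\<^sub>R x = complex_of_real r *\<^sub>C x"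
    and cinner_commute: "cinner x y = cnj (cinner y x)"
    and cinner_add_left: "cinner (x + y) z = cinner x z + cinner y z"
    and cinner_scaleC_left: "cinner (a *\<^sub>C x) y = a * cinner x y"
    and cinner_ge_zero: "0 \<le> Re (cinner x x)"
    and cinner_eq_zero_iff: "cinner x x = 0 \<longleftrightarrow> x = 0"
    and norm_eq_sqrt_cinner: "norm x = sqrt (Re (cinner x x))"

(* B(H) is the complex-linear part of the Banach space of bounded real-linear maps,
   with the same operator norm. *)

definition bounded_ops :: "('a::chilbert_space \<Rightarrow>\<^sub>L 'a) set" where
  "bounded_ops = {A :: 'a \<Rightarrow>\<^sub>L 'a. \<forall>c x. A (c *\<^sub>C x) = c *\<^sub>C A x}"

definition op_adj :: "('a::chilbert_space \<Rightarrow>\<^sub>L 'a) \<Rightarrow> ('a \<Rightarrow>\<^sub>L 'a)" where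
  "op_adj A = (THE B. B \<in> bounded_ops \<and> (\<forall>x y. cinner (A x) y = cinner x (B y)))"

definition positive_op :: "('a::chilbert_space \<Rightarrow>\<^sub>L 'a) \<Rightarrow> bool" where
  "positive_op A \<longleftrightarrow>
     A \<in> bounded_ops \<and> (\<forall>x. cinner (A x) x \<in> \<real> \<and> 0 \<le> Re (cinner (A x) x))"

definition op_le :: "('a::chilbert_space \<Rightarrow>\<^sub>L 'a) \<Rightarrow> ('a \<Rightarrow>\<^sub>L 'a) \<Rightarrow> bool" where
  "op_le A B \<longleftrightarrow> positive_op (B - A)"

definition op_spectrum :: "('a::chilbert_space \<Rightarrow>\<^sub>L 'a) \<Rightarrow> complex set" where
  "op_spectrum A = {z. \<not> (\<exists>B\<in>bounded_ops. \<forall>x.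
     B (A x - z *\<^sub>C x) = x \<and> A (B x) - z *\<^sub>C B x = x)}"

definition op_power :: "('a::chilbert_space \<Rightarrow>\<^sub>L 'a) \<Rightarrow> nat \<Rightarrow> ('a \<Rightarrow>\<^sub>L 'a)" where
  "op_power A k = ((\<lambda>B. A o\<^sub>L B) ^^ k) id_blinfun"

definition op_poly :: "real poly \<Rightarrow> ('a::chilbert_space \<Rightarrow>\<^sub>L 'a) \<Rightarrow> ('a \<Rightarrow>\<^sub>L 'a)" where
  "op_poly p A = (\<Sum>i\<le>degree p. coeff p i *\<^sub>R op_power A i)"

(* Continuous functional calculus f(A) for self-adjoint A and real f continuous on the
   spectrum of A (a compact subset of the reals): the common norm limit of p_n(A) over all
   sequences of real polynomials p_n that converge to f uniformly on the spectrum.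
   If f is not continuous on the spectrum, no such sequence exists and the value is
   unspecified. *)

definition op_fun :: "(real \<Rightarrow> real) \<Rightarrow> ('a::chilbert_space \<Rightarrow>\<^sub>L 'a) \<Rightarrow> ('a \<Rightarrow>\<^sub>L 'a)" where
  "op_fun f A = (THE B. \<forall>p :: nat \<Rightarrow> real poly.
     uniform_limit {r. complex_of_real r \<in> op_spectrum A} (\<lambda>n. poly (p n)) f sequentially
     \<longrightarrow> (\<lambda>n. op_poly (p n) A) \<longlonglongrightarrow> B)"

definition op_abs :: "('a::chilbert_space \<Rightarrow>\<^sub>L 'a) \<Rightarrow> ('a \<Rightarrow>\<^sub>L 'a)" where
  "op_abs A = op_fun sqrt (op_adj A o\<^sub>L A)"

(* Only the values of f on [0,\<infinity>) matter. The operators A, B act on the Hilbert space 'a.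
   Continuity is not required separately: multiples of the identity show that, unless 'a is the
   zero space, f is convex on [0,\<infinity>), hence continuous on (0,\<infinity>); a nonnegative
   such f with f 0 = 0 is continuous at 0 too. *)

definition operator_convex :: "'a::chilbert_space itself \<Rightarrow> (real \<Rightarrow> real) \<Rightarrow> bool" where
  "operator_convex _ f \<longleftrightarrow>
     (\<forall>(A :: 'a \<Rightarrow>\<^sub>L 'a) B. \<forall>t\<in>{0..1}. positive_op A \<longrightarrow> positive_op B \<longrightarrow>
        op_le (op_fun f ((1 - t) *\<^sub>R A + t *\<^sub>R B))
              ((1 - t) *\<^sub>R op_fun f A + t *\<^sub>R op_fun f B))"

abbreviation half_line_inv :: "(real \<Rightarrow> real) \<Rightarrow> real \<Rightarrow> real" where
  "half_line_inv f \<equiv> inv_into {0..} f"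

(* The supremum is taken in [0,\<infinity>). Inserting 0 changes nothing when unit vectors exist, as all
   values are nonnegative; it makes the empty supremum 0 on the zero space. *)

definition f_operator_radius ::
  "(real \<Rightarrow> real) \<Rightarrow> nat \<Rightarrow> (nat \<Rightarrow> ('a::chilbert_space \<Rightarrow>\<^sub>L 'a)) \<Rightarrow> real" where
  "f_operator_radius f n X = Sup (insert 0
     ((\<lambda>x. half_line_inv f (\<Sum>i=1..n. f (cmod (cinner (X i x) x)))) ` {x. norm x = 1}))"

end

theory Submission
  imports Defs "HOL-Computational_Algebra.Fundamental_Theorem_Algebra"
begin

text \<open>
  The index \<open>j\<close> is left out until the end. Fix a unit vector \<open>x\<close> and put \<open>a = \<langle>|S|\<^sup>2 x, x\<rangle> = \<parallel>S x\<parallel>\<^sup>2\<close> and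
  \<open>b = \<langle>|T|\<^sup>2 x, x\<rangle> = \<parallel>T x\<parallel>\<^sup>2\<close>. The Cauchy-Schwarz and the arithmetic-geometric mean
  inequalities bound \<open>|\<langle>T\<^sup>* S x, x\<rangle>| = |\<langle>S x, T x\<rangle>|\<close> by the midpoint \<open>m = (a + b) / 2\<close>.
  Let \<open>k\<close> be the slope of a supporting line of the convex function \<open>f\<close> at \<open>m\<close>. The functional
  calculus preserves order, so \<open>f(C) \<ge> f(m) + k (C - m)\<close> for every positive operator \<open>C\<close>. Take
  \<open>C = t |S|\<^sup>2 + (1 - t) |T|\<^sup>2\<close>, evaluate at \<open>x\<close> and integrate over \<open>t\<close>: the linear term
  averages to \<open>0\<close>, which leaves \<open>f(m) \<le> \<langle>(\<integral> f(C) dt) x, x\<rangle>\<close>. This single step, carried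
  out in \<open>hermite_hadamard_form\<close>, combines the scalar Hermite-Hadamard inequality with Jensen's
  inequality \<open>f(\<langle>C x, x\<rangle>) \<le> \<langle>f(C) x, x\<rangle>\<close>. Summation over \<open>j\<close> gives the first inequality.

  For the second one, operator convexity bounds the integrand by \<open>t f(|S|\<^sup>2) + (1 - t) f(|T|\<^sup>2)\<close>,
  whose integral is half the sum of the endpoints, and the operator norm is monotone on positive
  operators (\<open>norm_op_mono\<close>).

  The functional calculus rests on \<open>\<parallel>p(A)\<parallel> \<le> sup |p|\<close> for a real polynomial \<open>p\<close> and a
  self-adjoint \<open>A\<close>, where the supremum runs over the real spectrum (\<open>norm_op_poly_le\<close>). Two facts
  give it. A polynomial without roots in the real spectrum is invertible at \<open>A\<close>, because all
  its linear and quadratic factors are (\<open>self_adjoint_op_poly_invertible\<close>). And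
  \<open>B\<^sup>2 - \<parallel>B\<parallel>\<^sup>2\<close> is never invertible for self-adjoint \<open>B\<close> on a nonzero space, because this
  operator nearly annihilates the unit vectors on which \<open>B\<close> nearly attains its norm
  (\<open>not_invertible_sq_minus_norm_sq\<close>). With
  \<open>B = p(A)\<close> it follows that \<open>p\<^sup>2\<close> takes the value \<open>\<parallel>p(A)\<parallel>\<^sup>2\<close> on the spectrum.
\<close>

section \<open>Complex inner products\<close>

lemma cinner_add_right: "cinner x (y + z) = cinner x y + cinner x (z::'a::chilbert_space)"
  by (metis cinner_add_left cinner_commute complex_cnj_add)

lemma cinner_scaleC_right: "cinner x (c *\<^sub>C y) = cnj c * cinner x (y::'a::chilbert_space)"
  by (metis cinner_commute cinner_scaleC_left complex_cnj_mult)

lemma cinner_scaleR_left: "cinner (r *\<^sub>R x) y = of_real r * cinner x (y::'a::chilbert_space)"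
  by (simp add: scaleR_scaleC cinner_scaleC_left)

lemma cinner_scaleR_right: "cinner x (r *\<^sub>R y) = of_real r * cinner x (y::'a::chilbert_space)"
  by (simp add: scaleR_scaleC cinner_scaleC_right)

lemma cinner_minus_left: "cinner (- x) y = - cinner x (y::'a::chilbert_space)"
  using cinner_scaleR_left[of "-1" x y] by simp

lemma cinner_minus_right: "cinner x (- y) = - cinner x (y::'a::chilbert_space)"
  using cinner_scaleR_right[of x "-1" y] by simp

lemma cinner_diff_left: "cinner (x - y) z = cinner x z - cinner y (z::'a::chilbert_space)"
  using cinner_add_left[of x "- y" z] by (simp add: cinner_minus_left)

lemma cinner_diff_right: "cinner x (y - z) = cinner x y - cinner x (z::'a::chilbert_space)"
  using cinner_add_right[of x y "- z"] by (simp add: cinner_minus_right)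

lemma cinner_zero_left: "cinner 0 (y::'a::chilbert_space) = 0"
  using cinner_diff_left[of 0 0 y] by simp

lemma cinner_zero_right: "cinner (y::'a::chilbert_space) 0 = 0"
  using cinner_diff_right[of y 0 0] by simp

lemmas cinner_simps = cinner_add_left cinner_add_right cinner_diff_left cinner_diff_right
  cinner_scaleR_left cinner_scaleR_right cinner_minus_left cinner_minus_right
  cinner_zero_left cinner_zero_right cinner_scaleC_left cinner_scaleC_right

lemma Re_cinner_self: "Re (cinner x x) = (norm (x::'a::chilbert_space))\<^sup>2"
  by (simp add: norm_eq_sqrt_cinner cinner_ge_zero)

lemma Re_cinner_commute: "Re (cinner x y) = Re (cinner y (x::'a::chilbert_space))"
  by (subst cinner_commute) simp

lemma cinner_self: "cinner x x = of_real ((norm (x::'a::chilbert_space))\<^sup>2)"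
proof -
  have "Im (cinner x x) = 0"
    using arg_cong[OF cinner_commute[of x x], of Im] by simp
  then show ?thesis
    by (simp add: complex_eq_iff Re_cinner_self)
qed

lemma norm_add_sq:
  "(norm (x + y))\<^sup>2 = (norm x)\<^sup>2 + 2 * Re (cinner x y) + (norm (y::'a::chilbert_space))\<^sup>2"
  using Re_cinner_commute[of x y] by (simp add: Re_cinner_self[symmetric] cinner_simps)

lemma norm_diff_sq:
  "(norm (x - y))\<^sup>2 = (norm x)\<^sup>2 - 2 * Re (cinner x y) + (norm (y::'a::chilbert_space))\<^sup>2"
  using Re_cinner_commute[of x y] by (simp add: Re_cinner_self[symmetric] cinner_simps)

lemma norm_scaleC: "norm (c *\<^sub>C x) = cmod c * norm (x::'a::chilbert_space)"
proof -
  have "cinner (c *\<^sub>C x) (c *\<^sub>C x) = (c * cnj c) * cinner x x"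
    by (simp add: cinner_scaleC_left cinner_scaleC_right)
  also have "\<dots> = of_real ((cmod c)\<^sup>2 * (norm x)\<^sup>2)"
    unfolding of_real_mult by (simp only: complex_norm_square cinner_self)
  finally have "(norm (c *\<^sub>C x))\<^sup>2 = (cmod c * norm x)\<^sup>2"
    by (simp add: Re_cinner_self[symmetric] power_mult_distrib)
  then show ?thesis
    by (simp add: power2_eq_iff_nonneg)
qed

text \<open>The norm of the class is already known to satisfy the triangle inequality, and squaring
  that inequality yields the Cauchy-Schwarz inequality.\<close>

lemma Re_cinner_le: "Re (cinner x y) \<le> norm x * norm (y::'a::chilbert_space)"
proof -
  have "(norm (x + y))\<^sup>2 \<le> (norm x + norm y)\<^sup>2"
    by (intro power_mono norm_triangle_ineq) simp
  then show ?thesis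
    by (simp add: norm_add_sq power2_sum)
qed

lemma cmod_cinner_le: "cmod (cinner x y) \<le> norm x * norm (y::'a::chilbert_space)"
proof (cases "cinner x y = 0")
  case False
  define z where "z = cinner x y"
  (* Rotate x by a phase that makes the inner product real and nonnegative. *)
  define u where "u = cnj z / of_real (cmod z)"
  have z: "cmod z \<noteq> 0" using False by (simp add: z_def)
  have "u * z = of_real (cmod z)"
    using z complex_norm_square[of z]
    by (simp add: u_def field_simps power2_eq_square)
  then have "cmod z = Re (cinner (u *\<^sub>C x) y)"
    by (simp add: cinner_scaleC_left z_def)
  also have "\<dots> \<le> norm (u *\<^sub>C x) * norm y" by (rule Re_cinner_le)
  also have "norm (u *\<^sub>C x) = norm x" using z by (simp add: norm_scaleC u_def norm_divide)
  finally show ?thesis by (simp add: z_def)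
qed simp

lemma bounded_linear_cinner_left: "bounded_linear (\<lambda>x. cinner x (y::'a::chilbert_space))"
  by (rule bounded_linear_intro[of _ "norm y"])
    (simp_all add: cinner_simps cmod_cinner_le scaleR_conv_of_real)

lemma bounded_linear_cinner_right: "bounded_linear (\<lambda>x. cinner (y::'a::chilbert_space) x)"
proof (rule bounded_linear_intro[of _ "norm y"])
  show "norm (cinner y x) \<le> norm x * norm y" for x
    using cmod_cinner_le[of y x] by (simp add: mult.commute)
qed (simp_all add: cinner_simps scaleR_conv_of_real)

lemma bounded_linear_scaleC: "bounded_linear (\<lambda>x. c *\<^sub>C (x::'a::chilbert_space))"
  by (rule bounded_linear_intro[of _ "cmod c"])
    (simp_all add: scaleC_add_right scaleR_scaleC scaleC_scaleC norm_scaleC mult.commute)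

lemma cinner_eq_imp_eq:
  assumes "\<And>x. cinner x y = cinner x z"
  shows "y = (z::'a::chilbert_space)"
proof -
  have "cinner (y - z) (y - z) = 0" using assms[of "y - z"] by (simp add: cinner_diff_right)
  then show ?thesis by (simp add: cinner_eq_zero_iff)
qed

section \<open>Riesz representation and adjoints\<close>

text \<open>The representing vector is the minimiser of \<open>F x = \<parallel>x\<parallel>\<^sup>2 - 2 Re (\<phi> x)\<close>. The parallelogram law
  turns a minimising sequence into a Cauchy sequence, and the first variation of \<open>F\<close> at the
  minimum says that the functional and the inner product have the same real part. Replacing \<open>x\<close>
  by \<open>\<i> x\<close> identifies the imaginary parts.\<close>

lemma riesz_representation:
  fixes \<phi> :: "'a::chilbert_space \<Rightarrow> complex"
  assumes "bounded_linear \<phi>" and homog: "\<And>c x. \<phi> (c *\<^sub>C x) = c * \<phi> x"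
  obtains y where "\<And>x. \<phi> x = cinner x y"
proof -
  interpret bounded_linear \<phi> by fact
  define F where "F = (\<lambda>x. (norm x)\<^sup>2 - 2 * Re (\<phi> x))"
  obtain K where K: "\<And>x. norm (\<phi> x) \<le> norm x * K" using bounded by blast
  have lower: "- K\<^sup>2 \<le> F x" for x
  proof -
    have "Re (\<phi> x) \<le> norm x * K" using K complex_Re_le_cmod order_trans by blast
    moreover have "0 \<le> (norm x - K)\<^sup>2" by simp
    ultimately show ?thesis by (simp add: F_def power2_diff)
  qed
  define d where "d = Inf (range F)"
  have bdd: "bdd_below (range F)" using lower by (auto intro!: bdd_belowI2)
  have d: "d \<le> F x" for x unfolding d_def by (rule cInf_lower[OF _ bdd]) simp
  have "\<exists>x. F x < d + 1 / real (Suc k)" for k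
    using cInf_lessD[of "range F" "d + 1 / real (Suc k)"] by (auto simp: d_def)
  then obtain X where X: "\<And>k. F (X k) < d + 1 / real (Suc k)" by metis
  (* Parallelogram law: the linear part of F cancels. *)
  have mid: "F u + F v = 2 * F ((1/2) *\<^sub>R (u + v)) + (norm (u - v))\<^sup>2 / 2" for u v
    by (simp add: F_def norm_add_sq norm_diff_sq power_divide scaleR add cinner_simps field_simps)
  have close: "(norm (X j - X k))\<^sup>2 / 2 < 1 / real (Suc j) + 1 / real (Suc k)" for j k
    using mid[of "X j" "X k"] d[of "(1/2) *\<^sub>R (X j + X k)"] X[of j] X[of k] by linarith
  have "Cauchy X"
  proof (rule metric_CauchyI)
    fix e :: real assume "0 < e"
    then have "0 < e\<^sup>2 / 4" by simp
    from reals_Archimedean[OF this] obtain M where M: "inverse (real (Suc M)) < e\<^sup>2 / 4" ..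
    have "dist (X j) (X k) < e" if "M \<le> j" "M \<le> k" for j k
    proof -
      have "1 / real (Suc j) \<le> 1 / real (Suc M)" "1 / real (Suc k) \<le> 1 / real (Suc M)"
        using that by (simp_all add: divide_left_mono)
      then have "1 / real (Suc j) + 1 / real (Suc k) < e\<^sup>2 / 2"
        using M unfolding inverse_eq_divide by linarith
      with close[of j k] have "(norm (X j - X k))\<^sup>2 / 2 < e\<^sup>2 / 2" by (rule less_trans)
      then have "(norm (X j - X k))\<^sup>2 < e\<^sup>2" by simp
      then show ?thesis using \<open>0 < e\<close> by (simp add: dist_norm power2_less_imp_less[OF _ less_imp_le])
    qed
    then show "\<exists>M. \<forall>m\<ge>M. \<forall>n\<ge>M. dist (X m) (X n) < e" by blast
  qed
  then obtain y where y: "X \<longlonglongrightarrow> y" using Cauchy_convergent_iff convergent_def by blast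
  have "(\<lambda>k. F (X k)) \<longlonglongrightarrow> F y"
    unfolding F_def by (intro tendsto_intros tendsto y)
  moreover have "(\<lambda>k. d + 1 / real (Suc k)) \<longlonglongrightarrow> d + 0"
    by (intro tendsto_intros lim_1_over_n[THEN LIMSEQ_Suc])
  ultimately have Fy: "F y \<le> d"
    using LIMSEQ_le[of "\<lambda>k. F (X k)" "F y" "\<lambda>k. d + 1 / real (Suc k)" d] X less_imp_le by auto
  have Re_eq: "Re (\<phi> x) = Re (cinner x y)" for x
  proof -
    define a b where "a = Re (cinner x y) - Re (\<phi> x)" and "b = (norm x)\<^sup>2"
    (* First variation of F in direction x. *)
    have "0 \<le> 2 * t * a + t\<^sup>2 * b" for t
    proof -
      have "F y \<le> F (y + t *\<^sub>R x)" using Fy d order_trans by blast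
      then show ?thesis
        using Re_cinner_commute[of x y]
        by (simp add: F_def norm_add_sq add scaleR cinner_simps a_def b_def power_mult_distrib algebra_simps)
    qed
    note nonneg = this
    have b: "b \<ge> 0" by (simp add: b_def)
    (* The choice t = - a / (b + 1) makes the linear term win unless a = 0; b + 1 avoids dividing by 0. *)
    define s where "s = a / (b + 1)"
    have a_eq: "a = s * (b + 1)" using b by (simp add: s_def)
    have "0 \<le> - (s\<^sup>2 * (b + 2))"
      using nonneg[of "- s"] unfolding a_eq by (simp add: algebra_simps power2_eq_square)
    then have "s\<^sup>2 * (b + 2) = 0"
      using b by (intro antisym) auto
    then have "a = 0" using b a_eq by auto
    then show ?thesis by (simp add: a_def)
  qed
  have "\<phi> x = cinner x y" for x
    using Re_eq[of x] Re_eq[of "\<i> *\<^sub>C x"] by (simp add: complex_eq_iff homog cinner_scaleC_left)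
  then show thesis by (rule that)
qed

lemma bounded_opsD: "A \<in> bounded_ops \<Longrightarrow> A (c *\<^sub>C x) = c *\<^sub>C A x"
  by (simp add: bounded_ops_def)

lemma op_adj_exists:
  fixes A :: "'a::chilbert_space \<Rightarrow>\<^sub>L 'a"
  assumes A: "A \<in> bounded_ops"
  shows "\<exists>B\<in>bounded_ops. \<forall>x y. cinner (A x) y = cinner x (B y)"
proof -
  have "\<exists>z. \<forall>x. cinner (A x) y = cinner x z" for y
    by (rule riesz_representation[of "\<lambda>x. cinner (A x) y"])
      (auto intro!: bounded_linear_compose[OF bounded_linear_cinner_left] blinfun.bounded_linear_right
        simp: bounded_opsD[OF A] cinner_scaleC_left)
  then obtain g where g: "\<And>x y. cinner (A x) y = cinner x (g y)" by metis
  have add: "g (y + z) = g y + g z" for y z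
    by (rule cinner_eq_imp_eq) (simp add: cinner_simps flip: g)
  have scaleC: "g (c *\<^sub>C y) = c *\<^sub>C g y" for c y
    by (rule cinner_eq_imp_eq) (simp add: cinner_simps flip: g)
  have bound: "norm (g y) \<le> norm y * norm A" for y
  proof (cases "g y = 0")
    case False
    have "(norm (g y))\<^sup>2 = Re (cinner (A (g y)) y)" by (simp add: g Re_cinner_self)
    also have "\<dots> \<le> norm (A (g y)) * norm y" by (rule Re_cinner_le)
    also have "\<dots> \<le> (norm A * norm (g y)) * norm y"
      by (intro mult_right_mono norm_blinfun) simp
    finally show ?thesis using False by (simp add: power2_eq_square mult_ac)
  qed simp
  have "bounded_linear g"
    by (rule bounded_linear_intro[OF add _ bound]) (simp add: scaleR_scaleC scaleC)
  then have "blinfun_apply (Blinfun g) = g" by (rule bounded_linear_Blinfun_apply)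
  then show ?thesis
    by (intro bexI[of _ "Blinfun g"]) (simp_all add: g bounded_ops_def scaleC)
qed

lemma op_adj:
  assumes "A \<in> bounded_ops"
  shows op_adj_bounded_ops: "op_adj A \<in> bounded_ops"
    and cinner_op_adj: "cinner (A x) y = cinner x (op_adj A y)"
proof -
  have "\<exists>!B. B \<in> bounded_ops \<and> (\<forall>x y. cinner (A x) y = cinner x (B y))"
  proof (rule ex_ex1I)
    fix B C assume B: "B \<in> bounded_ops \<and> (\<forall>x y. cinner (A x) y = cinner x (B y))"
      and C: "C \<in> bounded_ops \<and> (\<forall>x y. cinner (A x) y = cinner x (C y))"
    show "B = C"
    proof (rule blinfun_eqI, rule cinner_eq_imp_eq)
      show "cinner x (B y) = cinner x (C y)" for x y
        using conjunct2[OF B, rule_format, of x y] conjunct2[OF C, rule_format, of x y] by simp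
    qed
  qed (use op_adj_exists[OF assms] in blast)
  note adj = theI'[OF this, folded op_adj_def]
  show "op_adj A \<in> bounded_ops" by (rule conjunct1[OF adj])
  show "cinner (A x) y = cinner x (op_adj A y)" by (rule conjunct2[OF adj, rule_format])
qed

section \<open>Bounded and invertible operators\<close>

lemma bounded_opsI:
  fixes A :: "'a::chilbert_space \<Rightarrow>\<^sub>L 'a"
  shows "(\<And>c x. A (c *\<^sub>C x) = c *\<^sub>C A x) \<Longrightarrow> A \<in> bounded_ops"
  by (simp add: bounded_ops_def)

lemma scaleC_zero_right: "c *\<^sub>C (0::'a::chilbert_space) = 0"
  using bounded_linear.linear[OF bounded_linear_scaleC] linear_0 by blast

lemma scaleC_scaleR_commute: "c *\<^sub>C r *\<^sub>R x = r *\<^sub>R c *\<^sub>C (x::'a::chilbert_space)"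
  by (simp add: scaleR_scaleC scaleC_scaleC mult.commute)

lemma scaleC_diff_right: "c *\<^sub>C (x - y) = c *\<^sub>C x - c *\<^sub>C (y::'a::chilbert_space)"
  using bounded_linear.linear[OF bounded_linear_scaleC] linear_diff by blast

lemma bounded_ops_zero: "0 \<in> bounded_ops"
  by (simp add: bounded_ops_def scaleC_zero_right)

lemma bounded_ops_id: "id_blinfun \<in> bounded_ops"
  by (simp add: bounded_ops_def)

lemma bounded_ops_add: "A \<in> bounded_ops \<Longrightarrow> B \<in> bounded_ops \<Longrightarrow> A + B \<in> bounded_ops"
  by (simp add: bounded_ops_def blinfun.bilinear_simps scaleC_add_right)

lemma bounded_ops_diff: "A \<in> bounded_ops \<Longrightarrow> B \<in> bounded_ops \<Longrightarrow> A - B \<in> bounded_ops"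
  by (simp add: bounded_ops_def blinfun.bilinear_simps scaleC_diff_right)

lemma bounded_ops_scaleR: "A \<in> bounded_ops \<Longrightarrow> r *\<^sub>R A \<in> bounded_ops"
  by (simp add: bounded_ops_def blinfun.bilinear_simps scaleC_scaleR_commute)

lemma bounded_ops_compose: "A \<in> bounded_ops \<Longrightarrow> B \<in> bounded_ops \<Longrightarrow> A o\<^sub>L B \<in> bounded_ops"
  by (simp add: bounded_ops_def)

definition op_invertible :: "('a::chilbert_space \<Rightarrow>\<^sub>L 'a) \<Rightarrow> bool" where
  "op_invertible B \<longleftrightarrow> (\<exists>C\<in>bounded_ops. B o\<^sub>L C = id_blinfun \<and> C o\<^sub>L B = id_blinfun)"

lemma op_invertible_compose:
  assumes "op_invertible A" "op_invertible B"
  shows "op_invertible (A o\<^sub>L B)"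
proof -
  obtain A' where A': "A' \<in> bounded_ops" "A o\<^sub>L A' = id_blinfun" "A' o\<^sub>L A = id_blinfun"
    using assms(1) by (auto simp: op_invertible_def)
  obtain B' where B': "B' \<in> bounded_ops" "B o\<^sub>L B' = id_blinfun" "B' o\<^sub>L B = id_blinfun"
    using assms(2) by (auto simp: op_invertible_def)
  have [simp]: "A (A' x) = x" "A' (A x) = x" "B (B' x) = x" "B' (B x) = x" for x
    using A'(2,3) B'(2,3) by (metis blinfun_apply_blinfun_compose blinfun_apply_id_blinfun)+
  show ?thesis
    unfolding op_invertible_def
    by (intro bexI[of _ "B' o\<^sub>L A'"] conjI blinfun_eqI)
      (simp_all add: bounded_ops_compose A' B')
qed

lemma op_invertible_scaleR:
  assumes "A \<in> bounded_ops" "r \<noteq> 0" "op_invertible (r *\<^sub>R A)"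
  shows "op_invertible A"
proof -
  obtain C where C: "C \<in> bounded_ops" "(r *\<^sub>R A) o\<^sub>L C = id_blinfun" "C o\<^sub>L (r *\<^sub>R A) = id_blinfun"
    using assms(3) by (auto simp: op_invertible_def)
  show ?thesis
    unfolding op_invertible_def
  proof (intro bexI[of _ "r *\<^sub>R C"] conjI blinfun_eqI)
    show "(A o\<^sub>L r *\<^sub>R C) x = id_blinfun x" "(r *\<^sub>R C o\<^sub>L A) x = id_blinfun x" for x
      using arg_cong[OF C(2), of "\<lambda>D. D x"] arg_cong[OF C(3), of "\<lambda>D. D x"]
      by (simp_all add: blinfun.bilinear_simps)
  qed (rule bounded_ops_scaleR[OF C(1)])
qed

lemma op_spectrum_of_real_iff:
  fixes A :: "'a::chilbert_space \<Rightarrow>\<^sub>L 'a"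
  shows "of_real r \<in> op_spectrum A \<longleftrightarrow> \<not> op_invertible (A - r *\<^sub>R id_blinfun)"
proof -
  have id_iff: "B = id_blinfun \<longleftrightarrow> (\<forall>x. B x = x)" for B :: "'a \<Rightarrow>\<^sub>L 'a"
    by (auto intro: blinfun_eqI)
  show ?thesis
    unfolding op_spectrum_def op_invertible_def id_iff
    by (simp add: blinfun.bilinear_simps scaleR_scaleC all_conj_distrib conj_commute)
qed

text \<open>A Lax-Milgram argument: for a small step \<open>s\<close> the map \<open>x \<mapsto> x - s (B x - y)\<close> is a contraction,
  and its fixed point solves \<open>B x = y\<close>. Coercivity also bounds the inverse.\<close>

lemma coercive_op_invertible:
  fixes B :: "'a::chilbert_space \<Rightarrow>\<^sub>L 'a"
  assumes B: "B \<in> bounded_ops" and "c > 0"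
    and coercive: "\<And>x. c * (norm x)\<^sup>2 \<le> Re (cinner (B x) x)"
  shows "op_invertible B"
proof -
  (* Adding c to the norm guarantees 0 < c / M <= 1 even on the zero space. *)
  define M where "M = norm B + c"
  have M: "M > 0" "c \<le> M" using \<open>c > 0\<close> norm_ge_zero[of B] unfolding M_def by linarith+
  have B_le: "norm (B x) \<le> M * norm x" for x
    using norm_blinfun[of B x] \<open>c > 0\<close> by (simp add: M_def distrib_right add_increasing2)
  (* This step minimises the bound 1 - 2 s c + s^2 M^2 for the squared contraction factor. *)
  define s where "s = c / M\<^sup>2"
  define k where "k = sqrt (1 - (c / M)\<^sup>2)"
  have "0 < c / M" "c / M \<le> 1" using M \<open>c > 0\<close> by simp_all
  then have "0 < (c / M)\<^sup>2" "(c / M)\<^sup>2 \<le> 1"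
    by (simp_all only: zero_less_power power_le_one less_imp_le)
  then have k: "0 \<le> k" "k < 1" and k_sq: "k\<^sup>2 = 1 - (c / M)\<^sup>2"
    unfolding k_def by simp_all
  have contraction: "norm (x - s *\<^sub>R B x) \<le> k * norm x" for x
  proof -
    have "(norm (x - s *\<^sub>R B x))\<^sup>2 = (norm x)\<^sup>2 - 2 * (s * Re (cinner (B x) x)) + s\<^sup>2 * (norm (B x))\<^sup>2"
      by (simp add: norm_diff_sq cinner_scaleR_right Re_cinner_commute[of x] power_mult_distrib)
    also have "\<dots> \<le> (norm x)\<^sup>2 - 2 * (s * (c * (norm x)\<^sup>2)) + s\<^sup>2 * (M * norm x)\<^sup>2"
      using \<open>c > 0\<close> M
      by (intro add_mono diff_mono mult_left_mono power_mono coercive B_le) (simp_all add: s_def)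
    also have "\<dots> = (k * norm x)\<^sup>2"
      unfolding power_mult_distrib k_sq using M by (simp add: s_def field_simps power2_eq_square)
    finally show ?thesis
      by (rule power2_le_imp_le) (simp add: k)
  qed
  have surj: "\<exists>x. B x = y" for y
  proof -
    have "\<exists>!x. (x - s *\<^sub>R B x) + s *\<^sub>R y = x"
    proof (rule banach_fix_type[OF k], intro allI)
      show "dist (u - s *\<^sub>R B u + s *\<^sub>R y) (v - s *\<^sub>R B v + s *\<^sub>R y) \<le> k * dist u v" for u v
        using contraction[of "u - v"]
        by (simp add: dist_norm blinfun.diff_right scaleR_diff_right algebra_simps)
    qed
    then obtain x where "x - s *\<^sub>R B x + s *\<^sub>R y = x" by blast
    then have "s *\<^sub>R (B x) = s *\<^sub>R y" by (auto simp: algebra_simps)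
    then show ?thesis using \<open>c > 0\<close> M by (auto simp: s_def)
  qed
  then obtain g where Bg: "\<And>y. B (g y) = y" by metis
  have below: "c * norm x \<le> norm (B x)" for x
  proof (cases "x = 0")
    case False
    have "c * (norm x)\<^sup>2 \<le> norm (B x) * norm x"
      using coercive Re_cinner_le order_trans by blast
    then show ?thesis using False by (simp add: power2_eq_square)
  qed simp
  have inj: "x = y" if "B x = B y" for x y
    using below[of "x - y"] that \<open>c > 0\<close> by (simp add: blinfun.diff_right mult_le_0_iff)
  have gB: "g (B x) = x" for x by (rule inj) (rule Bg)
  have add: "g (x + y) = g x + g y" for x y
    by (rule inj) (simp add: Bg blinfun.add_right)
  have scaleC: "g (a *\<^sub>C x) = a *\<^sub>C g x" for a x
    by (rule inj) (simp add: Bg bounded_opsD[OF B])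
  have "bounded_linear g"
  proof (rule bounded_linear_intro[OF add])
    show "norm (g x) \<le> norm x * (1 / c)" for x
      using below[of "g x"] \<open>c > 0\<close> by (simp add: Bg field_simps)
  qed (simp add: scaleR_scaleC scaleC)
  then have "blinfun_apply (Blinfun g) = g" by (rule bounded_linear_Blinfun_apply)
  then show ?thesis
    unfolding op_invertible_def
    by (intro bexI[of _ "Blinfun g"] conjI blinfun_eqI bounded_opsI) (simp_all add: Bg gB scaleC)
qed

section \<open>Polynomials of a self-adjoint operator\<close>

lemma op_power_0 [simp]: "op_power A 0 = id_blinfun"
  and op_power_Suc [simp]: "op_power A (Suc k) = A o\<^sub>L op_power A k"
  by (simp_all add: op_power_def)

lemma op_power_2: "op_power A 2 = A o\<^sub>L A"
  by (rule blinfun_eqI) (simp add: numeral_2_eq_2)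

lemma op_poly_altdef:
  assumes "degree p \<le> N"
  shows "op_poly p A = (\<Sum>i\<le>N. coeff p i *\<^sub>R op_power A i)"
  unfolding op_poly_def
  by (rule sum.mono_neutral_left) (use assms in \<open>auto simp: coeff_eq_0\<close>)

lemma op_poly_add: "op_poly (p + q) A = op_poly p A + op_poly q A"
proof -
  define N where "N = max (degree p) (degree q)"
  have "degree (p + q) \<le> N" "degree p \<le> N" "degree q \<le> N"
    by (simp_all add: N_def degree_add_le_max)
  then show ?thesis
    by (simp add: op_poly_altdef scaleR_add_left sum.distrib)
qed

lemma op_poly_smult: "op_poly (smult c p) A = c *\<^sub>R op_poly p A"
  by (simp add: op_poly_altdef[of "smult c p" "degree p"] op_poly_altdef[of p "degree p"]
      degree_smult_le scaleR_sum_right)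

lemma op_poly_diff: "op_poly (p - q) A = op_poly p A - op_poly q A"
  using op_poly_add[of p "smult (-1) q" A] unfolding op_poly_smult by simp

lemma op_poly_0 [simp]: "op_poly 0 A = 0"
  by (simp add: op_poly_def)

lemma op_poly_pCons: "op_poly (pCons a p) A = a *\<^sub>R id_blinfun + (A o\<^sub>L op_poly p A)"
proof -
  have "degree (pCons a p) \<le> Suc (degree p)" by (rule degree_pCons_le)
  then show ?thesis
    by (simp add: op_poly_altdef[of "pCons a p" "Suc (degree p)"] op_poly_altdef[of p "degree p"]
        sum.atMost_Suc_shift bounded_bilinear.sum_right[OF bounded_bilinear_blinfun_compose]
        bounded_bilinear.scaleR_right[OF bounded_bilinear_blinfun_compose] del: sum.atMost_Suc)
qed

lemma op_poly_mult: "op_poly (p * q) A = op_poly p A o\<^sub>L op_poly q A"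
proof (induction p)
  case (pCons a p)
  show ?case
    by (rule blinfun_eqI)
      (simp add: op_poly_add op_poly_smult op_poly_pCons pCons.IH blinfun.bilinear_simps)
qed simp

lemma op_poly_const: "op_poly [:a:] A = a *\<^sub>R id_blinfun"
  by (rule blinfun_eqI) (simp add: op_poly_pCons)

lemma op_poly_X: "op_poly [:0, 1:] A = A"
  by (rule blinfun_eqI) (simp add: op_poly_pCons blinfun.bilinear_simps)

definition self_adjoint_op :: "('a::chilbert_space \<Rightarrow>\<^sub>L 'a) \<Rightarrow> bool" where
  "self_adjoint_op A \<longleftrightarrow> A \<in> bounded_ops \<and> (\<forall>x y. cinner (A x) y = cinner x (A y))"

lemma Re_cinner_self_adjoint_sq:
  "self_adjoint_op A \<Longrightarrow> Re (cinner (A (A x)) x) = (norm (A x))\<^sup>2"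
  unfolding self_adjoint_op_def by (metis Re_cinner_self)

lemma self_adjoint_op_poly:
  assumes "self_adjoint_op A"
  shows "self_adjoint_op (op_poly p A)"
proof (induction p)
  case 0
  show ?case by (simp add: self_adjoint_op_def bounded_ops_zero cinner_simps)
next
  case (pCons a p)
  have comm: "op_poly p A (A x) = A (op_poly p A x)" for x
  proof -
    have "op_poly (p * [:0, 1:]) A x = op_poly ([:0, 1:] * p) A x" by (simp only: mult.commute)
    then show ?thesis by (simp only: op_poly_mult op_poly_X blinfun_apply_blinfun_compose)
  qed
  show ?case
    using assms pCons.IH
    by (simp add: self_adjoint_op_def op_poly_pCons bounded_ops_add bounded_ops_scaleR
        bounded_ops_id bounded_ops_compose cinner_simps blinfun.bilinear_simps comm)
qed

text \<open>A real polynomial is evaluated at a complex number by mapping its coefficients.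
  The next two lemmas let its complex roots be used in a factorisation over the reals.\<close>

lemma poly_map_poly_of_real_add:
  "poly (map_poly of_real (p + q)) z = poly (map_poly of_real p) z + poly (map_poly of_real q) (z::complex)"
proof -
  have "map_poly complex_of_real (p + q) = map_poly of_real p + map_poly of_real q"
    by (rule poly_eqI) (simp add: coeff_map_poly)
  then show ?thesis by simp
qed

lemma poly_map_poly_of_real_mult:
  "poly (map_poly of_real (p * q)) z = poly (map_poly of_real p) z * poly (map_poly of_real q) (z::complex)"
proof (induction p)
  case (pCons a p)
  have smult: "poly (map_poly of_real (smult c r)) z = of_real c * poly (map_poly of_real r) z" 
    for r :: "real poly" and c
    by (induction r) (simp_all add: map_poly_pCons algebra_simps)
  show ?case
    by (simp add: poly_map_poly_of_real_add smult map_poly_pCons pCons.IH algebra_simps)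
qed simp

text \<open>The polynomial is split into real factors, found from its complex roots one at a time.
  A real root \<open>r\<close> contributes \<open>A - r\<close>, which is invertible because \<open>r\<close> is outside the spectrum.
  A root \<open>a + \<i> b\<close> with \<open>b \<noteq> 0\<close> contributes \<open>(A - a)\<^sup>2 + b\<^sup>2\<close>, which is coercive because
  \<open>A - a\<close> is self-adjoint. Working with real quadratic factors keeps all polynomials of \<open>A\<close>
  self-adjoint.\<close>

lemma self_adjoint_op_poly_invertible:
  fixes A :: "'a::chilbert_space \<Rightarrow>\<^sub>L 'a"
  assumes A: "self_adjoint_op A"
  shows "q \<noteq> 0 \<Longrightarrow> (\<And>r. of_real r \<in> op_spectrum A \<Longrightarrow> poly q r \<noteq> 0) \<Longrightarrow>
    op_invertible (op_poly q A)"
proof (induction "degree q" arbitrary: q rule: less_induct)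
  case less
  show ?case
  proof (cases "degree q = 0")
    case True
    then obtain a where q: "q = [:a:]" by (rule degree_eq_zeroE)
    show ?thesis
      unfolding op_invertible_def q op_poly_const
      by (intro bexI[of _ "(1 / a) *\<^sub>R id_blinfun"] conjI blinfun_eqI)
        (use less.prems(1) q in
          \<open>simp_all add: blinfun.bilinear_simps bounded_ops_scaleR bounded_ops_id\<close>)
  next
    case False
    have "\<not> constant (poly (map_poly complex_of_real q))"
      using False by (simp add: constant_degree degree_map_poly)
    then obtain \<mu> where root: "poly (map_poly complex_of_real q) \<mu> = 0"
      using fundamental_theorem_of_algebra by blast
    obtain g where g: "g dvd q" "degree g > 0" "op_invertible (op_poly g A)"
    proof (cases "Im \<mu> = 0")
      case True
      have "poly (map_poly complex_of_real q) (of_real (Re \<mu>)) = of_real (poly q (Re \<mu>))"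
        by (induction q) (simp_all add: map_poly_pCons)
      moreover have "of_real (Re \<mu>) = \<mu>" using True by (simp add: complex_eq_iff)
      ultimately have root': "poly q (Re \<mu>) = 0" using root by simp
      then have "of_real (Re \<mu>) \<notin> op_spectrum A" using less.prems(2) by blast
      then have "op_invertible (A - Re \<mu> *\<^sub>R id_blinfun)" by (simp add: op_spectrum_of_real_iff)
      also have "A - Re \<mu> *\<^sub>R id_blinfun = op_poly [:- Re \<mu>, 1:] A"
        by (rule blinfun_eqI) (simp add: op_poly_pCons blinfun.bilinear_simps)
      finally show thesis
        using root' by (intro that[of "[:- Re \<mu>, 1:]"]) (simp_all add: poly_eq_0_iff_dvd)
    next
      case False
      define a b where "a = Re \<mu>" and "b = Im \<mu>"
      (* The real quadratic with roots a + i b and a - i b. *)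
      define g where "g = [:a\<^sup>2 + b\<^sup>2, - 2 * a, 1:]"
      have b: "b \<noteq> 0" using False by (simp add: b_def)
      have deg_g: "degree g = 2" by (simp add: g_def)
      have g_root: "poly (map_poly complex_of_real g) \<mu> = 0"
        by (simp add: g_def map_poly_pCons complex_eq_iff a_def b_def algebra_simps power2_eq_square)
      (* The remainder is affine with real coefficients and has a nonreal root, so it vanishes. *)
      define r where "r = q mod g"
      have "r = 0 \<or> degree r < degree g"
        unfolding r_def by (rule degree_mod_less) (simp add: g_def)
      then have "degree r \<le> 1" using deg_g by auto
      obtain u r' where r': "r = pCons u r'" by (cases r)
      have "degree r' = 0"
        using \<open>degree r \<le> 1\<close> by (simp add: r' degree_pCons_eq_if split: if_splits)
      then obtain v where r: "r = [:u, v:]" using r' by (metis degree_eq_zeroE)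
      have q_eq: "g * (q div g) + r = q" by (simp add: r_def)
      have "poly (map_poly complex_of_real (g * (q div g) + r)) \<mu> = 0"
        unfolding q_eq by (rule root)
      then have "poly (map_poly complex_of_real r) \<mu> = 0"
        by (simp add: poly_map_poly_of_real_add poly_map_poly_of_real_mult g_root)
      then have "of_real u + \<mu> * of_real v = 0" by (simp add: r map_poly_pCons)
      then have "r = 0" using b by (auto simp: complex_eq_iff r b_def)
      then have "g dvd q" by (simp add: r_def mod_eq_0_iff_dvd)
      moreover have "op_invertible (op_poly g A)"
      proof (rule coercive_op_invertible)
        show "op_poly g A \<in> bounded_ops" 
          using self_adjoint_op_poly[OF A] by (simp add: self_adjoint_op_def)
        show "0 < b\<^sup>2" using b by simp
        fix x
        have "Re (cinner (op_poly g A x) x) = (norm (A x - a *\<^sub>R x))\<^sup>2 + b\<^sup>2 * (norm x)\<^sup>2"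
          by (simp add: g_def op_poly_pCons blinfun.bilinear_simps cinner_simps norm_diff_sq
              Re_cinner_self_adjoint_sq[OF A] Re_cinner_self power_mult_distrib algebra_simps)
        then show "b\<^sup>2 * (norm x)\<^sup>2 \<le> Re (cinner (op_poly g A x) x)" by simp
      qed
      ultimately show thesis using deg_g by (intro that) simp_all
    qed
    from g(1) obtain d where d: "q = g * d" ..
    with less.prems(1) have nz: "g \<noteq> 0" "d \<noteq> 0" by auto
    then have "degree d < degree q" using g(2) by (simp add: d degree_mult_eq)
    then have "op_invertible (op_poly d A)"
      using less.prems(2) nz by (intro less.hyps) (auto simp: d)
    then show ?thesis
      unfolding d op_poly_mult by (rule op_invertible_compose[OF g(3)])
  qed
qed

text \<open>With \<open>M = \<parallel>B\<parallel>\<close>, self-adjointness gives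
  \<open>\<parallel>(B\<^sup>2 - M\<^sup>2) x\<parallel>\<^sup>2 \<le> M\<^sup>2 (M\<^sup>2 \<parallel>x\<parallel>\<^sup>2 - \<parallel>B x\<parallel>\<^sup>2)\<close>. If \<open>B\<^sup>2 - M\<^sup>2\<close> were invertible, the left
  side would be bounded below by a multiple of \<open>\<parallel>x\<parallel>\<^sup>2\<close>, which would force the norm of \<open>B\<close>
  strictly below \<open>M\<close>. On the zero space every operator is invertible, hence the nonzero vector.\<close>

lemma not_invertible_sq_minus_norm_sq:
  fixes B :: "'a::chilbert_space \<Rightarrow>\<^sub>L 'a"
  assumes B: "self_adjoint_op B" and x0: "x0 \<noteq> (0::'a)"
  shows "\<not> op_invertible ((B o\<^sub>L B) - (norm B)\<^sup>2 *\<^sub>R id_blinfun)"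
proof
  define M where "M = norm B"
  define D where "D = (B o\<^sub>L B) - M\<^sup>2 *\<^sub>R id_blinfun"
  assume "op_invertible ((B o\<^sub>L B) - (norm B)\<^sup>2 *\<^sub>R id_blinfun)"
  then obtain C where "C o\<^sub>L D = id_blinfun"
    by (auto simp: op_invertible_def D_def M_def)
  then have CD: "C (D x) = x" for x
    by (metis blinfun_apply_blinfun_compose blinfun_apply_id_blinfun)
  define K where "K = norm C + 1"
  have K: "K > 0" using norm_ge_zero[of C] unfolding K_def by linarith
  have below: "norm x \<le> K * norm (D x)" for x
  proof -
    have "norm x \<le> norm C * norm (D x)" using norm_blinfun[of C "D x"] by (simp add: CD)
    also have "\<dots> \<le> K * norm (D x)" by (simp add: K_def distrib_right)
    finally show ?thesis .
  qed
  have D_le: "(norm (D x))\<^sup>2 \<le> M\<^sup>2 * (M\<^sup>2 * (norm x)\<^sup>2 - (norm (B x))\<^sup>2)" for x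
  proof -
    have "(norm (D x))\<^sup>2 = (norm (B (B x)))\<^sup>2 - 2 * (M\<^sup>2 * (norm (B x))\<^sup>2) + (M\<^sup>2 * norm x)\<^sup>2"
    proof -
      have "Re (cinner (B (B x)) x) = (norm (B x))\<^sup>2"
        by (rule Re_cinner_self_adjoint_sq[OF B])
      then show ?thesis
        by (simp add: D_def blinfun.bilinear_simps norm_diff_sq cinner_scaleR_right)
    qed
    also have "(norm (B (B x)))\<^sup>2 \<le> (M * norm (B x))\<^sup>2"
      unfolding M_def by (intro power_mono norm_blinfun) simp
    finally show ?thesis by (simp add: power_mult_distrib algebra_simps)
  qed
  have sq: "(norm x)\<^sup>2 \<le> K\<^sup>2 * (M\<^sup>2 * (M\<^sup>2 * (norm x)\<^sup>2 - (norm (B x))\<^sup>2))" for x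
  proof -
    have "(norm x)\<^sup>2 \<le> (K * norm (D x))\<^sup>2" by (intro power_mono below) simp
    also have "\<dots> = K\<^sup>2 * (norm (D x))\<^sup>2" by (simp add: power_mult_distrib)
    also have "\<dots> \<le> K\<^sup>2 * (M\<^sup>2 * (M\<^sup>2 * (norm x)\<^sup>2 - (norm (B x))\<^sup>2))"
      by (intro mult_left_mono D_le) simp
    finally show ?thesis .
  qed
  have M: "M > 0"
  proof (rule ccontr)
    assume "\<not> M > 0"
    then have "M = 0" by (simp add: M_def)
    with sq[of x0] x0 show False by simp
  qed
  define r where "r = M\<^sup>2 - 1 / (K\<^sup>2 * M\<^sup>2)"
  have B_le: "(norm (B x))\<^sup>2 \<le> r * (norm x)\<^sup>2" for x
    using sq[of x] K M by (simp add: r_def field_simps)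
  have "0 \<le> r * (norm x0)\<^sup>2" using B_le[of x0] zero_le_power2 order_trans by blast
  then have r: "r \<ge> 0" using x0 by (simp add: zero_le_mult_iff)
  have "norm B \<le> sqrt r"
  proof (rule norm_blinfun_bound)
    show "norm (B x) \<le> sqrt r * norm x" for x
      using real_sqrt_le_mono[OF B_le[of x]] by (simp add: real_sqrt_mult)
  qed (simp add: r)
  then have "M\<^sup>2 \<le> r" using r M by (simp add: M_def real_le_rsqrt sqrt_ge_absD)
  moreover have "0 < 1 / (K\<^sup>2 * M\<^sup>2)" using K M by simp
  ultimately show False by (simp only: r_def)
qed

text \<open>If \<open>p\<^sup>2 - \<parallel>p(A)\<parallel>\<^sup>2\<close> had no root in the real spectrum, it would be invertible at \<open>A\<close>,
  contradicting the previous lemma for \<open>B = p(A)\<close>. The degenerate case where this polynomial is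
  \<open>0\<close> needs some point of the spectrum, which the same argument for \<open>p(x) = x\<close> provides.\<close>

lemma norm_op_poly_le:
  fixes A :: "'a::chilbert_space \<Rightarrow>\<^sub>L 'a"
  assumes A: "self_adjoint_op A" and "0 \<le> e"
    and bound: "\<And>r. of_real r \<in> op_spectrum A \<Longrightarrow> \<bar>poly p r\<bar> \<le> e"
  shows "norm (op_poly p A) \<le> e"
proof (rule ccontr)
  assume less: "\<not> norm (op_poly p A) \<le> e"
  have "\<exists>x0::'a. x0 \<noteq> 0"
  proof (rule ccontr)
    assume "\<not> ?thesis"
    then have "op_poly p A = 0" by (intro blinfun_eqI) auto
    then show False using less \<open>0 \<le> e\<close> by simp
  qed
  then obtain x0 :: 'a where x0: "x0 \<noteq> 0" ..
  have no_root: "p' * p' - [:(norm (op_poly p' A))\<^sup>2:] = 0 \<or>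
      (\<exists>r. of_real r \<in> op_spectrum A \<and> (poly p' r)\<^sup>2 = (norm (op_poly p' A))\<^sup>2)" for p'
  proof (rule ccontr)
    let ?q = "p' * p' - [:(norm (op_poly p' A))\<^sup>2:]"
    assume "\<not> ?thesis"
    then have "op_invertible (op_poly ?q A)"
      by (intro self_adjoint_op_poly_invertible[OF A]) (auto simp: power2_eq_square)
    moreover have "op_poly ?q A
        = (op_poly p' A o\<^sub>L op_poly p' A) - (norm (op_poly p' A))\<^sup>2 *\<^sub>R id_blinfun"
      by (simp only: op_poly_diff op_poly_mult op_poly_const)
    ultimately show False
      using not_invertible_sq_minus_norm_sq[OF self_adjoint_op_poly[OF A] x0] by simp
  qed
  have "[:0, 1:] * [:0, 1:] - [:c:] \<noteq> 0" for c :: real by simp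
  with no_root[of "[:0, 1:]"] obtain r0 where r0: "of_real r0 \<in> op_spectrum A" by blast
  have "\<exists>r. of_real r \<in> op_spectrum A \<and> (poly p r)\<^sup>2 = (norm (op_poly p A))\<^sup>2"
    using no_root[of p]
  proof
    assume "p * p - [:(norm (op_poly p A))\<^sup>2:] = 0"
    then have "poly (p * p) r0 = poly [:(norm (op_poly p A))\<^sup>2:] r0" by simp
    then show ?thesis using r0 by (auto simp: power2_eq_square)
  qed
  then obtain r where r: "of_real r \<in> op_spectrum A" "(poly p r)\<^sup>2 = (norm (op_poly p A))\<^sup>2" by blast
  have "sqrt ((poly p r)\<^sup>2) = sqrt ((norm (op_poly p A))\<^sup>2)" by (simp only: r(2))
  then have "\<bar>poly p r\<bar> = norm (op_poly p A)" by simp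
  then show False using bound[OF r(1)] less by simp
qed

section \<open>Positive operators\<close>

text \<open>Polarisation: the form \<open>\<langle>A x, x\<rangle>\<close> is real at \<open>u + v\<close> and at \<open>u + \<i> v\<close>.\<close>

lemma positive_op_imp_self_adjoint:
  fixes A :: "'a::chilbert_space \<Rightarrow>\<^sub>L 'a"
  assumes A: "positive_op A"
  shows "self_adjoint_op A"
proof -
  have ops: "A \<in> bounded_ops" and Im: "Im (cinner (A x) x) = 0" for x
    using A by (auto simp: positive_op_def complex_is_Real_iff)
  have "cinner (A u) v = cinner u (A v)" for u v
  proof -
    have "Im (cinner (A u) v) + Im (cinner (A v) u) = 0"
      using Im[of "u + v"] Im[of u] Im[of v]
      by (simp add: cinner_simps blinfun.bilinear_simps)
    moreover have "Re (cinner (A v) u) - Re (cinner (A u) v) = 0"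
      using Im[of "u + \<i> *\<^sub>C v"] Im[of u] Im[of v]
      by (simp add: cinner_simps blinfun.bilinear_simps bounded_opsD[OF ops])
    moreover have "cinner u (A v) = cnj (cinner (A v) u)" by (rule cinner_commute)
    ultimately show ?thesis by (simp add: complex_eq_iff)
  qed
  with ops show ?thesis by (simp add: self_adjoint_op_def)
qed

lemma self_adjoint_imp_positive_op:
  assumes "self_adjoint_op A" "\<And>x. 0 \<le> Re (cinner (A x) x)"
  shows "positive_op A"
proof -
  have "cinner (A x) x \<in> \<real>" for x
    using assms(1) cinner_commute[of "A x" x]
    by (simp add: self_adjoint_op_def complex_is_Real_iff complex_eq_iff)
  then show ?thesis using assms by (simp add: positive_op_def self_adjoint_op_def)
qed

lemma positive_opD:
  "positive_op A \<Longrightarrow> A \<in> bounded_ops"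
  "positive_op A \<Longrightarrow> 0 \<le> Re (cinner (A x) x)"
  by (simp_all add: positive_op_def)

lemma positive_op_add: "positive_op A \<Longrightarrow> positive_op B \<Longrightarrow> positive_op (A + B)"
  by (simp add: positive_op_def bounded_ops_add blinfun.bilinear_simps cinner_simps)

lemma positive_op_scaleR: "positive_op A \<Longrightarrow> 0 \<le> r \<Longrightarrow> positive_op (r *\<^sub>R A)"
  by (simp add: positive_op_def bounded_ops_scaleR blinfun.bilinear_simps cinner_simps)

lemma positive_op_zero: "positive_op 0"
  by (simp add: positive_op_def bounded_ops_zero cinner_simps)

lemma positive_op_id: "positive_op id_blinfun"
  by (simp add: positive_op_def bounded_ops_id cinner_self)

lemma positive_op_sum: "(\<And>i. i \<in> I \<Longrightarrow> positive_op (F i)) \<Longrightarrow> positive_op (sum F I)"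
  by (induction I rule: infinite_finite_induct) (auto simp: positive_op_zero intro: positive_op_add)

lemma abs_Re_cinner_op_le:
  fixes A :: "'a::chilbert_space \<Rightarrow>\<^sub>L 'a"
  shows "\<bar>Re (cinner (A x) x)\<bar> \<le> norm A * (norm x)\<^sup>2"
proof -
  have "\<bar>Re (cinner (A x) x)\<bar> \<le> cmod (cinner (A x) x)" by (rule abs_Re_le_cmod)
  also have "\<dots> \<le> norm (A x) * norm x" by (rule cmod_cinner_le)
  also have "\<dots> \<le> norm A * norm x * norm x" by (intro mult_right_mono norm_blinfun) simp
  finally show ?thesis by (simp add: power2_eq_square mult.assoc)
qed

abbreviation real_spectrum :: "('a::chilbert_space \<Rightarrow>\<^sub>L 'a) \<Rightarrow> real set" where
  "real_spectrum A \<equiv> {r. complex_of_real r \<in> op_spectrum A}"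

text \<open>Outside \<open>[0, \<parallel>A\<parallel>]\<close> one of \<open>A - r\<close> and \<open>r - A\<close> is coercive.\<close>

lemma real_spectrum_positive_op:
  fixes A :: "'a::chilbert_space \<Rightarrow>\<^sub>L 'a"
  assumes A: "positive_op A"
  shows "real_spectrum A \<subseteq> {0..norm A}"
proof
  fix r assume "r \<in> real_spectrum A"
  then have notinv: "\<not> op_invertible (A - r *\<^sub>R id_blinfun)" by (simp add: op_spectrum_of_real_iff)
  have ops: "A - r *\<^sub>R id_blinfun \<in> bounded_ops"
    using A by (intro bounded_ops_diff bounded_ops_scaleR bounded_ops_id positive_opD)
  have form: "Re (cinner ((A - r *\<^sub>R id_blinfun) x) x) = Re (cinner (A x) x) - r * (norm x)\<^sup>2" for x
    by (simp add: blinfun.bilinear_simps cinner_simps Re_cinner_self)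
  have "0 \<le> r"
  proof (rule ccontr)
    assume r: "\<not> 0 \<le> r"
    have "op_invertible (A - r *\<^sub>R id_blinfun)"
      by (rule coercive_op_invertible[OF ops, of "- r"]) (use r positive_opD(2)[OF A] in \<open>simp_all add: form\<close>)
    then show False using notinv by simp
  qed
  moreover have "r \<le> norm A"
  proof (rule ccontr)
    assume r: "\<not> r \<le> norm A"
    have "op_invertible ((- 1) *\<^sub>R (A - r *\<^sub>R id_blinfun))"
    proof (rule coercive_op_invertible[of _ "r - norm A"])
      show "(r - norm A) * (norm x)\<^sup>2 \<le> Re (cinner (((- 1) *\<^sub>R (A - r *\<^sub>R id_blinfun)) x) x)" for x
        using abs_Re_cinner_op_le[of A x]
        by (simp add: blinfun.bilinear_simps cinner_simps Re_cinner_self left_diff_distrib)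
      show "(- 1) *\<^sub>R (A - r *\<^sub>R id_blinfun) \<in> bounded_ops" by (rule bounded_ops_scaleR[OF ops])
    qed (use r in simp)
    then show False using notinv op_invertible_scaleR[OF ops, of "-1"] by simp
  qed
  ultimately show "r \<in> {0..norm A}" by simp
qed

section \<open>Continuous functional calculus\<close>

lemma continuous_uniform_limit_polys:
  fixes f :: "real \<Rightarrow> real"
  assumes "continuous_on {a..b} f"
  obtains p :: "nat \<Rightarrow> real poly" where "uniform_limit {a..b} (\<lambda>n. poly (p n)) f sequentially"
proof -
  have "\<exists>p :: real poly. \<forall>x\<in>{a..b}. \<bar>f x - poly p x\<bar> < 1 / real (Suc n)" for n
  proof -
    obtain g where g: "real_polynomial_function g" "\<And>x. x \<in> {a..b} \<Longrightarrow> \<bar>f x - g x\<bar> < 1 / real (Suc n)"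
      by (rule Stone_Weierstrass_real_polynomial_function[OF compact_Icc assms, of "1 / real (Suc n)"]) auto
    obtain c m where "g = (\<lambda>x. \<Sum>i\<le>m. c i * x ^ i)"
      using real_polynomial_function_imp_sum[OF g(1)] by blast
    then have "g = poly (\<Sum>i\<le>m. monom (c i) i)" by (simp add: fun_eq_iff poly_sum poly_monom)
    then show ?thesis using g(2) by blast
  qed
  then obtain p :: "nat \<Rightarrow> real poly"
    where p: "\<And>n x. x \<in> {a..b} \<Longrightarrow> \<bar>f x - poly (p n) x\<bar> < 1 / real (Suc n)" by metis
  have "uniform_limit {a..b} (\<lambda>n. poly (p n)) f sequentially"
  proof (rule uniform_limitI)
    fix e :: real assume "0 < e"
    then have "\<forall>\<^sub>F n in sequentially. inverse (real (Suc n)) < e"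
      using LIMSEQ_inverse_real_of_nat by (rule order_tendstoD(2)[rotated])
    then show "\<forall>\<^sub>F n in sequentially. \<forall>x\<in>{a..b}. dist (poly (p n) x) (f x) < e"
    proof eventually_elim
      case (elim n)
      have "dist (poly (p n) x) (f x) < e" if "x \<in> {a..b}" for x
        using p[OF that, of n] elim by (simp add: dist_real_def abs_minus_commute inverse_eq_divide)
      then show ?case by blast
    qed
  qed
  then show thesis by (rule that)
qed

text \<open>The norm bound for polynomials makes \<open>p\<^sub>n(A)\<close> a Cauchy sequence whenever \<open>p\<^sub>n\<close> converges
  uniformly on the spectrum, and makes the limit independent of the sequence. Hence the definite
  description in the definition of \<^const>\<open>op_fun\<close> denotes as soon as one approximating sequence
  exists; for a function continuous on the half-line, Weierstrass provides one.\<close>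

lemma op_fun_tendsto:
  fixes A :: "'a::chilbert_space \<Rightarrow>\<^sub>L 'a"
  assumes A: "self_adjoint_op A"
    and p: "uniform_limit (real_spectrum A) (\<lambda>n. poly (p n)) f sequentially"
  shows "(\<lambda>n. op_poly (p n) A) \<longlonglongrightarrow> op_fun f A"
proof -
  have diff: "norm (op_poly u A - op_poly v A) \<le> e"
    if u: "\<forall>r\<in>real_spectrum A. dist (poly u r) (f r) < e / 2"
      and v: "\<forall>r\<in>real_spectrum A. dist (poly v r) (f r) < e / 2" and "0 < e" for u v e
    unfolding op_poly_diff[symmetric]
  proof (rule norm_op_poly_le[OF A])
    show "\<bar>poly (u - v) r\<bar> \<le> e" if r: "of_real r \<in> op_spectrum A" for r
    proof -
      have "\<bar>poly u r - f r\<bar> < e / 2" "\<bar>poly v r - f r\<bar> < e / 2"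
        using u v r by (auto simp: dist_real_def)
      then show ?thesis unfolding poly_diff by linarith
    qed
  qed (use \<open>0 < e\<close> in simp)
  have "Cauchy (\<lambda>n. op_poly (p n) A)"
  proof (rule metric_CauchyI)
    fix e :: real assume "0 < e"
    then have "\<forall>\<^sub>F n in sequentially. \<forall>r\<in>real_spectrum A. dist (poly (p n) r) (f r) < e / 2 / 2"
      by (intro uniform_limitD[OF p]) simp
    then obtain N where N: "\<And>n. n \<ge> N \<Longrightarrow> \<forall>r\<in>real_spectrum A. dist (poly (p n) r) (f r) < e / 2 / 2"
      unfolding eventually_sequentially by blast
    have "dist (op_poly (p m) A) (op_poly (p n) A) < e" if "m \<ge> N" "n \<ge> N" for m n
      using diff[OF N[OF that(1)] N[OF that(2)]] \<open>0 < e\<close> by (simp add: dist_norm)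
    then show "\<exists>M. \<forall>m\<ge>M. \<forall>n\<ge>M. dist (op_poly (p m) A) (op_poly (p n) A) < e" by blast
  qed
  then obtain B where B: "(\<lambda>n. op_poly (p n) A) \<longlonglongrightarrow> B"
    using Cauchy_convergent_iff convergent_def by blast
  have "(\<lambda>n. op_poly (q n) A) \<longlonglongrightarrow> B"
    if q: "uniform_limit (real_spectrum A) (\<lambda>n. poly (q n)) f sequentially" for q
  proof -
    have "(\<lambda>n. op_poly (q n) A - op_poly (p n) A) \<longlonglongrightarrow> 0"
    proof (rule tendstoI)
      fix e :: real assume "0 < e"
      then have "0 < e / 2 / 2" by simp
      from uniform_limitD[OF p this] uniform_limitD[OF q this]
      show "\<forall>\<^sub>F n in sequentially. dist (op_poly (q n) A - op_poly (p n) A) 0 < e"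
      proof eventually_elim
        case (elim n)
        show ?case using diff[OF elim(2,1)] \<open>0 < e\<close> by simp
      qed
    qed
    from tendsto_add[OF this B] show ?thesis by simp
  qed
  then have "op_fun f A = B"
    unfolding op_fun_def using p LIMSEQ_unique[OF _ B] by (intro the_equality) blast+
  then show ?thesis using B by simp
qed

lemma positive_op_uniform_limit_polys:
  assumes "positive_op A" "continuous_on {0..} f" "norm A \<le> R"
  obtains p :: "nat \<Rightarrow> real poly" where "uniform_limit {0..R} (\<lambda>n. poly (p n)) f sequentially"
    "uniform_limit (real_spectrum A) (\<lambda>n. poly (p n)) f sequentially"
proof -
  have "continuous_on {0..R} f" using assms(2) by (rule continuous_on_subset) auto
  then obtain p :: "nat \<Rightarrow> real poly" where p: "uniform_limit {0..R} (\<lambda>n. poly (p n)) f sequentially"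
    by (rule continuous_uniform_limit_polys)
  moreover have "real_spectrum A \<subseteq> {0..R}"
    using real_spectrum_positive_op[OF assms(1)] assms(3) by fastforce
  ultimately show thesis using uniform_limit_on_subset that by blast
qed

lemma op_fun_poly:
  "self_adjoint_op A \<Longrightarrow> op_fun (poly q) A = op_poly q A"
  using op_fun_tendsto[of A "\<lambda>_. q" "poly q"] by (simp add: LIMSEQ_const_iff uniform_limit_const)

lemma op_fun_diff:
  assumes A: "positive_op A" and f: "continuous_on {0..} f" and g: "continuous_on {0..} g"
  shows "op_fun (\<lambda>r. f r - g r) A = op_fun f A - op_fun g A"
proof -
  note sa = positive_op_imp_self_adjoint[OF A]
  obtain p where p: "uniform_limit (real_spectrum A) (\<lambda>n. poly (p n)) f sequentially"
    using positive_op_uniform_limit_polys[OF A f order_refl] by metis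
  obtain q where q: "uniform_limit (real_spectrum A) (\<lambda>n. poly (q n)) g sequentially"
    using positive_op_uniform_limit_polys[OF A g order_refl] by metis
  have "uniform_limit (real_spectrum A) (\<lambda>n. poly (p n - q n)) (\<lambda>r. f r - g r) sequentially"
    unfolding poly_diff by (intro uniform_limit_intros p q)
  from op_fun_tendsto[OF sa this] have "(\<lambda>n. op_poly (p n) A - op_poly (q n) A) \<longlonglongrightarrow> op_fun (\<lambda>r. f r - g r) A"
    by (simp add: op_poly_diff)
  moreover have "(\<lambda>n. op_poly (p n) A - op_poly (q n) A) \<longlonglongrightarrow> op_fun f A - op_fun g A"
    by (intro tendsto_diff op_fun_tendsto sa p q)
  ultimately show ?thesis by (rule LIMSEQ_unique)
qed

text \<open>A polynomial uniformly close to \<open>f\<close> exceeds \<open>e\<close> by little on the spectrum, which lies in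
  \<open>[0, \<parallel>A\<parallel>]\<close>, so the bound for polynomials passes to the limit.\<close>

lemma norm_op_fun_le:
  assumes A: "positive_op A" and f: "continuous_on {0..} f" and "0 \<le> e"
    and bound: "\<And>r. r \<in> {0..norm A} \<Longrightarrow> \<bar>f r\<bar> \<le> e"
  shows "norm (op_fun f A) \<le> e"
proof (rule field_le_epsilon)
  fix d :: real assume "0 < d"
  note sa = positive_op_imp_self_adjoint[OF A]
  obtain p where p: "uniform_limit (real_spectrum A) (\<lambda>n. poly (p n)) f sequentially"
    using positive_op_uniform_limit_polys[OF A f order_refl] by metis
  from uniform_limitD[OF p \<open>0 < d\<close>]
  have "\<forall>\<^sub>F n in sequentially. norm (op_poly (p n) A) \<le> e + d"
  proof eventually_elim
    case (elim n)
    show ?case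
    proof (rule norm_op_poly_le[OF sa])
      fix r assume r: "of_real r \<in> op_spectrum A"
      then have "\<bar>f r\<bar> \<le> e" using real_spectrum_positive_op[OF A] by (intro bound) auto
      moreover have "\<bar>poly (p n) r - f r\<bar> < d" using elim r by (simp add: dist_real_def)
      ultimately show "\<bar>poly (p n) r\<bar> \<le> e + d" by linarith
    qed (use \<open>0 \<le> e\<close> \<open>0 < d\<close> in simp)
  qed
  then show "norm (op_fun f A) \<le> e + d"
    using op_fun_tendsto[OF sa p] Lim_norm_ubound[OF sequentially_bot] by blast
qed

lemma tendsto_blinfun_apply_const:
  "F \<longlonglongrightarrow> B \<Longrightarrow> (\<lambda>n. blinfun_apply (F n) x) \<longlonglongrightarrow> B x"
  by (intro tendsto_intros)

lemma self_adjoint_op_limit: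
  fixes F :: "nat \<Rightarrow> 'a::chilbert_space \<Rightarrow>\<^sub>L 'a"
  assumes F: "\<And>n. self_adjoint_op (F n)" and lim: "F \<longlonglongrightarrow> B"
  shows "self_adjoint_op B"
  unfolding self_adjoint_op_def
proof (intro conjI bounded_opsI allI)
  note applied = tendsto_blinfun_apply_const[OF lim]
  show "B (c *\<^sub>C x) = c *\<^sub>C B x" for c x
  proof (rule LIMSEQ_unique)
    show "(\<lambda>n. F n (c *\<^sub>C x)) \<longlonglongrightarrow> B (c *\<^sub>C x)" by (rule applied)
    have "F n (c *\<^sub>C x) = c *\<^sub>C F n x" for n
      using F[of n] by (intro bounded_opsD) (simp add: self_adjoint_op_def)
    then show "(\<lambda>n. F n (c *\<^sub>C x)) \<longlonglongrightarrow> c *\<^sub>C B x"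
      using bounded_linear.tendsto[OF bounded_linear_scaleC applied] by simp
  qed
  show "cinner (B x) y = cinner x (B y)" for x y
  proof (rule LIMSEQ_unique)
    show "(\<lambda>n. cinner (F n x) y) \<longlonglongrightarrow> cinner (B x) y"
      by (rule bounded_linear.tendsto[OF bounded_linear_cinner_left applied])
    have "cinner (F n x) y = cinner x (F n y)" for n
      using F[of n] by (simp add: self_adjoint_op_def)
    then show "(\<lambda>n. cinner (F n x) y) \<longlonglongrightarrow> cinner x (B y)"
      using bounded_linear.tendsto[OF bounded_linear_cinner_right applied] by simp
  qed
qed

lemma self_adjoint_op_fun:
  assumes A: "positive_op A" and f: "continuous_on {0..} f"
  shows "self_adjoint_op (op_fun f A)"
proof -
  note sa = positive_op_imp_self_adjoint[OF A]
  obtain p where p: "uniform_limit (real_spectrum A) (\<lambda>n. poly (p n)) f sequentially"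
    using positive_op_uniform_limit_polys[OF A f order_refl] by metis
  show ?thesis
    by (rule self_adjoint_op_limit[OF self_adjoint_op_poly[OF sa] op_fun_tendsto[OF sa p]])
qed

text \<open>If \<open>0 \<le> f \<le> c\<close> then \<open>|f - c| \<le> c\<close>, so \<open>\<parallel>f(A) - c\<parallel> \<le> c\<close>, and this bounds the form of
  \<open>f(A)\<close> below by \<open>0\<close>.\<close>

lemma positive_op_fun:
  fixes A :: "'a::chilbert_space \<Rightarrow>\<^sub>L 'a"
  assumes A: "positive_op A" and f: "continuous_on {0..} f" and nonneg: "\<And>r. 0 \<le> r \<Longrightarrow> 0 \<le> f r"
  shows "positive_op (op_fun f A)"
proof (rule self_adjoint_imp_positive_op[OF self_adjoint_op_fun[OF A f]])
  fix x :: 'a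
  have "continuous_on {0..norm A} f" using f by (rule continuous_on_subset) auto
  then obtain m where m: "m \<in> {0..norm A}" "\<And>r. r \<in> {0..norm A} \<Longrightarrow> f r \<le> f m"
    using continuous_attains_sup[of "{0..norm A}" f] by auto
  define c where "c = f m"
  have c: "0 \<le> c" using m nonneg by (simp add: c_def)
  have eq: "op_fun (\<lambda>r. f r - poly [:c:] r) A = op_fun f A - c *\<^sub>R id_blinfun"
    using op_fun_diff[OF A f, of "poly [:c:]"]
    by (simp only: op_fun_poly[OF positive_op_imp_self_adjoint[OF A]] op_poly_const continuous_on_poly
        continuous_on_id)
  have "norm (op_fun (\<lambda>r. f r - poly [:c:] r) A) \<le> c"
  proof (rule norm_op_fun_le[OF A _ c])
    show "continuous_on {0..} (\<lambda>r. f r - poly [:c:] r)" by (intro continuous_intros f)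
    show "\<bar>f r - poly [:c:] r\<bar> \<le> c" if "r \<in> {0..norm A}" for r
      using nonneg[of r] m(2)[OF that] that by (simp add: c_def)
  qed
  then have "norm (op_fun f A - c *\<^sub>R id_blinfun) * (norm x)\<^sup>2 \<le> c * (norm x)\<^sup>2"
    unfolding eq by (rule mult_right_mono) simp
  with abs_Re_cinner_op_le[of "op_fun f A - c *\<^sub>R id_blinfun" x]
  have "\<bar>Re (cinner ((op_fun f A - c *\<^sub>R id_blinfun) x) x)\<bar> \<le> c * (norm x)\<^sup>2" by (rule order_trans)
  then show "0 \<le> Re (cinner (op_fun f A x) x)"
    by (simp add: blinfun.bilinear_simps cinner_simps Re_cinner_self abs_le_iff)
qed

text \<open>The form in which convexity meets the functional calculus: the affine function will be a
  supporting line.\<close>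

lemma op_fun_affine_minorant:
  fixes A :: "'a::chilbert_space \<Rightarrow>\<^sub>L 'a"
  assumes A: "positive_op A" and f: "continuous_on {0..} f"
    and minorant: "\<And>r. 0 \<le> r \<Longrightarrow> \<alpha> + k * r \<le> f r"
  shows "\<alpha> * (norm x)\<^sup>2 + k * Re (cinner (A x) x) \<le> Re (cinner (op_fun f A x) x)"
proof -
  have "positive_op (op_fun (\<lambda>r. f r - poly [:\<alpha>, k:] r) A)"
    using minorant by (intro positive_op_fun A continuous_intros f) (simp add: mult.commute)
  moreover have "op_fun (\<lambda>r. f r - poly [:\<alpha>, k:] r) A = op_fun f A - op_poly [:\<alpha>, k:] A"
    using op_fun_diff[OF A f, of "poly [:\<alpha>, k:]"]
    by (simp only: op_fun_poly[OF positive_op_imp_self_adjoint[OF A]] continuous_on_poly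
        continuous_on_id)
  ultimately have "0 \<le> Re (cinner ((op_fun f A - op_poly [:\<alpha>, k:] A) x) x)"
    using positive_opD(2) by metis
  then show ?thesis
    by (simp add: op_poly_pCons blinfun.bilinear_simps cinner_simps Re_cinner_self)
qed

lemma op_adj_compose_self:
  fixes S :: "'a::chilbert_space \<Rightarrow>\<^sub>L 'a"
  assumes S: "S \<in> bounded_ops"
  shows cinner_op_adj_compose_self: "cinner ((op_adj S o\<^sub>L S) x) x = of_real ((norm (S x))\<^sup>2)"
    and positive_op_adj_compose_self: "positive_op (op_adj S o\<^sub>L S)"
proof -
  show eq: "cinner ((op_adj S o\<^sub>L S) x) x = of_real ((norm (S x))\<^sup>2)" for x
    using cinner_op_adj[OF S, of x "S x", symmetric] cinner_commute[of "op_adj S (S x)" x]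
    by (simp only: blinfun_apply_blinfun_compose cinner_self complex_cnj_complex_of_real)
  show "positive_op (op_adj S o\<^sub>L S)"
    unfolding positive_op_def using eq by (simp add: bounded_ops_compose op_adj_bounded_ops S)
qed

text \<open>The squares of polynomials that converge to the square root converge to the identity function.\<close>

lemma op_abs_squared:
  assumes S: "S \<in> bounded_ops"
  shows "op_power (op_abs S) 2 = op_adj S o\<^sub>L S"
proof -
  define A where "A = op_adj S o\<^sub>L S"
  have A: "positive_op A" using positive_op_adj_compose_self[OF S] by (simp add: A_def)
  note sa = positive_op_imp_self_adjoint[OF A]
  have "continuous_on {0..} sqrt" by (intro continuous_intros)
  then obtain p where p: "uniform_limit {0..norm A} (\<lambda>n. poly (p n)) sqrt sequentially"
      "uniform_limit (real_spectrum A) (\<lambda>n. poly (p n)) sqrt sequentially"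
    using positive_op_uniform_limit_polys[OF A _ order_refl] by metis
  have bounded: "bounded (sqrt ` {0..norm A})"
    by (intro compact_imp_bounded compact_continuous_image continuous_intros compact_Icc)
  have "uniform_limit {0..norm A} (\<lambda>n r. poly (p n) r * poly (p n) r) (\<lambda>r. sqrt r * sqrt r) sequentially"
    by (intro uniform_lim_mult p(1) bounded)
  then have "uniform_limit {0..norm A} (\<lambda>n. poly (p n * p n)) (poly [:0, 1:]) sequentially"
    by (rule uniform_limit_cong'[THEN iffD1, rotated -1]) simp_all
  then have "uniform_limit (real_spectrum A) (\<lambda>n. poly (p n * p n)) (poly [:0, 1:]) sequentially"
    using real_spectrum_positive_op[OF A] by (rule uniform_limit_on_subset)
  from op_fun_tendsto[OF sa this] have "(\<lambda>n. op_poly (p n) A o\<^sub>L op_poly (p n) A) \<longlonglongrightarrow> A"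
    unfolding op_fun_poly[OF sa] op_poly_X op_poly_mult .
  moreover have "(\<lambda>n. op_poly (p n) A o\<^sub>L op_poly (p n) A) \<longlonglongrightarrow> (op_fun sqrt A o\<^sub>L op_fun sqrt A)"
    by (intro bounded_bilinear.tendsto[OF bounded_bilinear_blinfun_compose] op_fun_tendsto sa p(2))
  ultimately show ?thesis
    unfolding op_power_2 op_abs_def A_def[symmetric] by (rule LIMSEQ_unique[symmetric])
qed

lemma continuous_on_op_poly:
  "continuous_on I P \<Longrightarrow> continuous_on I (\<lambda>t. op_poly p (P t))"
  by (induction p)
    (auto simp: op_poly_pCons intro!: continuous_intros
      bounded_bilinear.continuous_on[OF bounded_bilinear_blinfun_compose])

text \<open>On a compact parameter set the norms of the operators are bounded, so one polynomial
  approximates \<open>f\<close> on all their spectra at once. Thus the map is a uniform limit of continuous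
  ones.\<close>

lemma continuous_on_op_fun:
  fixes P :: "'b::topological_space \<Rightarrow> 'a::chilbert_space \<Rightarrow>\<^sub>L 'a"
  assumes I: "compact I" and P: "continuous_on I P" and pos: "\<And>t. t \<in> I \<Longrightarrow> positive_op (P t)"
    and f: "continuous_on {0..} f"
  shows "continuous_on I (\<lambda>t. op_fun f (P t))"
proof -
  have "bounded (P ` I)" using I P by (intro compact_imp_bounded compact_continuous_image)
  then obtain R where R: "\<And>t. t \<in> I \<Longrightarrow> norm (P t) \<le> R" by (auto simp: bounded_iff)
  have "continuous_on {0..R} f" using f by (rule continuous_on_subset) auto
  then obtain p :: "nat \<Rightarrow> real poly" where p: "uniform_limit {0..R} (\<lambda>n. poly (p n)) f sequentially"
    by (rule continuous_uniform_limit_polys)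
  have "uniform_limit I (\<lambda>n t. op_poly (p n) (P t)) (\<lambda>t. op_fun f (P t)) sequentially"
  proof (rule uniform_limitI)
    fix e :: real assume "0 < e"
    then have "0 < e / 2" by simp
    from uniform_limitD[OF p this]
    show "\<forall>\<^sub>F n in sequentially. \<forall>t\<in>I. dist (op_poly (p n) (P t)) (op_fun f (P t)) < e"
    proof eventually_elim
      case (elim n)
      show ?case
      proof
        fix t assume t: "t \<in> I"
        have cont: "continuous_on {0..} (poly (p n))" by (intro continuous_intros)
        have "op_fun (\<lambda>r. poly (p n) r - f r) (P t) = op_poly (p n) (P t) - op_fun f (P t)"
          using op_fun_diff[OF pos[OF t] cont f] op_fun_poly[OF positive_op_imp_self_adjoint[OF pos[OF t]]]
          by simp
        moreover have "norm (op_fun (\<lambda>r. poly (p n) r - f r) (P t)) \<le> e / 2"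
        proof (rule norm_op_fun_le[OF pos[OF t]])
          show "continuous_on {0..} (\<lambda>r. poly (p n) r - f r)" by (intro continuous_intros f)
          show "\<bar>poly (p n) r - f r\<bar> \<le> e / 2" if "r \<in> {0..norm (P t)}" for r
            using elim that R[OF t] by (force simp: dist_real_def)
        qed (use \<open>0 < e\<close> in simp)
        ultimately show "dist (op_poly (p n) (P t)) (op_fun f (P t)) < e"
          using \<open>0 < e\<close> by (simp add: dist_norm)
      qed
    qed
  qed
  then show ?thesis
    by (rule uniform_limit_theorem[rotated]) (simp_all add: continuous_on_op_poly P)
qed

text \<open>The spectrum of a scalar operator has at most one point, where constant polynomials suffice.
  It is this lemma that turns operator convexity into convexity and continuity of \<open>f\<close>, so it
  speaks of arbitrary \<open>f\<close>.\<close>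

lemma op_fun_scalar:
  "op_fun f (c *\<^sub>R id_blinfun :: 'a::chilbert_space \<Rightarrow>\<^sub>L 'a) = f c *\<^sub>R id_blinfun"
proof -
  let ?A = "c *\<^sub>R id_blinfun :: 'a \<Rightarrow>\<^sub>L 'a"
  have sa: "self_adjoint_op ?A"
    by (simp add: self_adjoint_op_def bounded_ops_scaleR bounded_ops_id blinfun.bilinear_simps cinner_simps)
  have "real_spectrum ?A \<subseteq> {c}"
  proof
    fix r assume r: "r \<in> real_spectrum ?A"
    have "op_invertible (?A - r *\<^sub>R id_blinfun)" if "r \<noteq> c"
      unfolding op_invertible_def
      by (intro bexI[of _ "(1 / (c - r)) *\<^sub>R id_blinfun"] conjI blinfun_eqI)
        (use that in \<open>simp_all add: blinfun.bilinear_simps bounded_ops_scaleR bounded_ops_id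
            flip: scaleR_diff_left\<close>)
    then show "r \<in> {c}" using r by (auto simp: op_spectrum_of_real_iff)
  qed
  then have "uniform_limit (real_spectrum ?A) (\<lambda>n. poly [:f c:]) f sequentially"
    by (intro uniform_limitI always_eventually) auto
  from op_fun_tendsto[OF sa this] show ?thesis
    by (simp add: op_poly_const LIMSEQ_const_iff)
qed

section \<open>Monotonicity of the norm and integrals of operators\<close>

text \<open>For \<open>d > \<parallel>D\<parallel>\<close> the form of \<open>C\<close> is at most \<open>d \<parallel>\<cdot>\<parallel>\<^sup>2\<close>. Nonnegativity of the form at
  \<open>x - C x / d\<close> then gives \<open>\<parallel>C x\<parallel> \<le> d \<parallel>x\<parallel>\<close>.\<close>

lemma norm_op_mono:
  fixes C D :: "'a::chilbert_space \<Rightarrow>\<^sub>L 'a"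
  assumes C: "positive_op C" and le: "op_le C D"
  shows "norm C \<le> norm D"
proof (rule field_le_epsilon)
  fix e :: real assume "0 < e"
  define d where "d = norm D + e"
  have d: "0 < d" using norm_ge_zero[of D] \<open>0 < e\<close> unfolding d_def by linarith
  have form_le: "Re (cinner (C x) x) \<le> d * (norm x)\<^sup>2" for x
  proof -
    have "0 \<le> Re (cinner ((D - C) x) x)" using le unfolding op_le_def by (rule positive_opD)
    then have "Re (cinner (C x) x) \<le> Re (cinner (D x) x)" by (simp add: blinfun.diff_left cinner_simps)
    also have "\<dots> \<le> norm D * (norm x)\<^sup>2" using abs_Re_cinner_op_le[of D x] by linarith
    also have "\<dots> \<le> d * (norm x)\<^sup>2" using \<open>0 < e\<close> by (intro mult_right_mono) (simp_all add: d_def)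
    finally show ?thesis .
  qed
  have "norm (C x) \<le> d * norm x" for x
  proof -
    define y where "y = C x"
    define s where "s = 1 / d"
    have sa: "cinner (C y) x = cinner y y"
      using positive_op_imp_self_adjoint[OF C] by (simp add: self_adjoint_op_def y_def)
    have "0 \<le> Re (cinner (C (x - s *\<^sub>R y)) (x - s *\<^sub>R y))" by (rule positive_opD(2)[OF C])
    also have "\<dots> = Re (cinner (C x) x) - 2 * (s * (norm y)\<^sup>2) + s\<^sup>2 * Re (cinner (C y) y)"
      using sa Re_cinner_self[of y]
      by (simp add: blinfun.bilinear_simps cinner_simps y_def[symmetric] power2_eq_square algebra_simps)
    also have "\<dots> \<le> d * (norm x)\<^sup>2 - 2 * (s * (norm y)\<^sup>2) + s\<^sup>2 * (d * (norm y)\<^sup>2)"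
      by (intro add_mono diff_mono mult_left_mono form_le) (use d in \<open>simp_all add: s_def\<close>)
    also have "\<dots> = ((d * norm x)\<^sup>2 - (norm y)\<^sup>2) / d"
      using d by (simp add: s_def field_simps power2_eq_square)
    finally have "(norm y)\<^sup>2 \<le> (d * norm x)\<^sup>2" using d by (simp add: zero_le_divide_iff)
    moreover have "0 \<le> d * norm x" using d by simp
    ultimately show ?thesis unfolding y_def by (rule power2_le_imp_le)
  qed
  then show "norm C \<le> norm D + e"
    using d unfolding d_def[symmetric] by (intro norm_blinfun_bound) simp_all
qed

lemma bounded_linear_cinner_apply:
  "bounded_linear (\<lambda>B :: 'a::chilbert_space \<Rightarrow>\<^sub>L 'a. cinner (B x) y)"
  by (rule bounded_linear_compose[OF bounded_linear_cinner_left blinfun.bounded_linear_left])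

lemma cinner_integral:
  fixes F :: "real \<Rightarrow> 'a::chilbert_space \<Rightarrow>\<^sub>L 'a"
  assumes "F integrable_on S"
  shows "((\<lambda>t. cinner (F t x) y) has_integral cinner (integral S F x) y) S"
  using has_integral_linear[OF integrable_integral[OF assms] bounded_linear_cinner_apply[of x y]]
  by (simp add: o_def)

lemma positive_op_integral:
  fixes F :: "real \<Rightarrow> 'a::chilbert_space \<Rightarrow>\<^sub>L 'a"
  assumes int: "F integrable_on S" and pos: "\<And>t. t \<in> S \<Longrightarrow> positive_op (F t)"
  shows "positive_op (integral S F)"
proof (rule self_adjoint_imp_positive_op)
  have eval: "((\<lambda>t. F t x) has_integral integral S F x) S" for x
    using has_integral_linear[OF integrable_integral[OF int] blinfun.bounded_linear_left[of x]]
    by (simp add: o_def)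
  show "self_adjoint_op (integral S F)"
    unfolding self_adjoint_op_def
  proof (intro conjI bounded_opsI allI)
    show "integral S F (c *\<^sub>C x) = c *\<^sub>C integral S F x" for c x
    proof (rule has_integral_unique)
      show "((\<lambda>t. F t (c *\<^sub>C x)) has_integral integral S F (c *\<^sub>C x)) S" by (rule eval)
      have "((\<lambda>t. c *\<^sub>C F t x) has_integral c *\<^sub>C integral S F x) S"
        using has_integral_linear[OF eval bounded_linear_scaleC] by (simp add: o_def)
      then show "((\<lambda>t. F t (c *\<^sub>C x)) has_integral c *\<^sub>C integral S F x) S"
        by (rule has_integral_eq[rotated]) (simp add: bounded_opsD positive_opD(1) pos)
    qed
    show "cinner (integral S F x) y = cinner x (integral S F y)" for x y
    proof (rule has_integral_unique)
      show "((\<lambda>t. cinner (F t x) y) has_integral cinner (integral S F x) y) S"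
        by (rule cinner_integral[OF int])
      have "((\<lambda>t. cinner x (F t y)) has_integral cinner x (integral S F y)) S"
        using has_integral_linear[OF eval bounded_linear_cinner_right] by (simp add: o_def)
      then show "((\<lambda>t. cinner (F t x) y) has_integral cinner x (integral S F y)) S"
        by (rule has_integral_eq[rotated])
          (use positive_op_imp_self_adjoint[OF pos] in \<open>simp add: self_adjoint_op_def\<close>)
    qed
  qed
  show "0 \<le> Re (cinner (integral S F x) x)" for x
  proof (rule has_integral_nonneg)
    show "((\<lambda>t. Re (cinner (F t x) x)) has_integral Re (cinner (integral S F x) x)) S"
      using has_integral_linear[OF cinner_integral[OF int] bounded_linear_Re] by (simp add: o_def)
  qed (rule positive_opD(2)[OF pos])
qed

section \<open>Convex functions on the half-line\<close>

text \<open>Operator convexity is tested on multiples of the identity.\<close>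

lemma operator_convex_imp_convex_on:
  fixes x0 :: "'a::chilbert_space"
  assumes f: "operator_convex TYPE('a) f" and x0: "x0 \<noteq> 0"
  shows "convex_on {0..} f"
proof (rule convex_onI)
  fix t a b :: real
  assume t: "0 < t" "t < 1" and ab: "a \<in> {0..}" "b \<in> {0..}"
  define c where "c = (1 - t) * a + t * b"
  let ?I = "id_blinfun :: 'a \<Rightarrow>\<^sub>L 'a"
  have "positive_op (a *\<^sub>R ?I)" "positive_op (b *\<^sub>R ?I)"
    using ab by (simp_all add: positive_op_scaleR positive_op_id)
  then have "op_le (op_fun f ((1 - t) *\<^sub>R a *\<^sub>R ?I + t *\<^sub>R b *\<^sub>R ?I))
      ((1 - t) *\<^sub>R op_fun f (a *\<^sub>R ?I) + t *\<^sub>R op_fun f (b *\<^sub>R ?I))"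
    using f t unfolding operator_convex_def by (simp del: scaleR_scaleR)
  moreover have "(1 - t) *\<^sub>R a *\<^sub>R ?I + t *\<^sub>R b *\<^sub>R ?I = c *\<^sub>R ?I"
    by (simp add: c_def scaleR_add_left)
  ultimately have "positive_op ((1 - t) *\<^sub>R f a *\<^sub>R ?I + t *\<^sub>R f b *\<^sub>R ?I - f c *\<^sub>R ?I)"
    by (simp only: op_fun_scalar op_le_def)
  from positive_opD(2)[OF this, of x0]
  have "0 \<le> ((1 - t) * f a + t * f b - f c) * (norm x0)\<^sup>2"
    by (simp add: blinfun.bilinear_simps cinner_simps Re_cinner_self algebra_simps)
  then show "f ((1 - t) *\<^sub>R a + t *\<^sub>R b) \<le> (1 - t) * f a + t * f b"
    using x0 by (simp add: zero_le_mult_iff c_def)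
qed simp

text \<open>The scalar properties of \<open>f\<close> that the argument uses. They make \<open>f\<close> a continuous increasing
  bijection of the half-line, so that its inverse there is monotone.\<close>

locale half_line_gauge =
  fixes f :: "real \<Rightarrow> real"
  assumes convex: "convex_on {0..} f" and zero: "f 0 = 0" and strict: "strict_mono_on {0..} f"
begin

lemma mono: "0 \<le> a \<Longrightarrow> a \<le> b \<Longrightarrow> f a \<le> f b"
  using strict_mono_on_imp_mono_on[OF strict] by (auto simp: mono_on_def)

lemma nonneg: "0 \<le> a \<Longrightarrow> 0 \<le> f a"
  using mono[of 0 a] by (simp add: zero)

lemma star_shaped: "0 \<le> t \<Longrightarrow> t \<le> 1 \<Longrightarrow> 0 \<le> a \<Longrightarrow> f (t * a) \<le> t * f a"
  using convex_onD[OF convex, of t 0 a] by (simp add: zero)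

text \<open>Convexity gives continuity in the interior only. At the endpoint \<open>0\<close>,
  \<open>f\<close> is squeezed between \<open>0\<close> and its chord over \<open>[0, 1]\<close>.\<close>

lemma continuous: "continuous_on {0..} f"
  unfolding continuous_on_eq_continuous_within
proof
  fix x :: real assume x: "x \<in> {0..}"
  show "continuous (at x within {0..}) f"
  proof (cases "x = 0")
    case False
    have "continuous_on {0<..} f"
      by (rule convex_on_continuous) (auto intro: convex_on_subset[OF convex])
    then have "isCont f x" using x False by (simp add: continuous_on_eq_continuous_at)
    then show ?thesis by (rule continuous_at_imp_continuous_at_within)
  next
    case True
    have lim: "((\<lambda>r. r * f 1) \<longlongrightarrow> 0 * f 1) (at 0 within {0..})" by (intro tendsto_intros)
    have ev: "\<forall>\<^sub>F r in at 0 within {0..}. r \<in> {0..1::real}"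
      unfolding eventually_at by (intro exI[of _ 1]) (auto simp: dist_real_def)
    have "(f \<longlongrightarrow> 0) (at 0 within {0..})"
    proof (rule tendsto_sandwich[OF _ _ tendsto_const])
      show "\<forall>\<^sub>F r in at 0 within {0..}. 0 \<le> f r" using ev by eventually_elim (simp add: nonneg)
      show "\<forall>\<^sub>F r in at 0 within {0..}. f r \<le> r * f 1"
        using ev by eventually_elim (use star_shaped[of _ 1] in simp)
      show "((\<lambda>r. r * f 1) \<longlongrightarrow> 0) (at 0 within {0..})" using lim by simp
    qed
    then show ?thesis by (simp add: True continuous_within zero)
  qed
qed

text \<open>Convexity gives \<open>R f(1) \<le> f(R)\<close> for \<open>R \<ge> 1\<close>, so \<open>f\<close> is unbounded and the intermediate
  value theorem applies.\<close>

lemma surj: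
  assumes "0 \<le> y"
  shows "y \<in> f ` {0..}"
proof -
  have f1: "0 < f 1" using strict_mono_onD[OF strict, of 0 1] by (simp add: zero)
  define R where "R = max 1 (y / f 1)"
  have R: "1 \<le> R" "y / f 1 \<le> R" by (simp_all add: R_def)
  have "f ((1 / R) * R) \<le> (1 / R) * f R" using R by (intro star_shaped) simp_all
  then have "R * f 1 \<le> f R" using R by (simp add: field_simps)
  moreover have "y \<le> R * f 1" using R f1 by (simp add: field_simps)
  ultimately have "y \<le> f R" by simp
  moreover have "continuous_on {0..R} f" using continuous by (rule continuous_on_subset) auto
  ultimately obtain x where "0 \<le> x" "x \<le> R" "f x = y"
    using IVT'[of f 0 y R] assms R by (auto simp: zero)
  then show ?thesis by auto
qed

lemma inv_nonneg: "0 \<le> y \<Longrightarrow> 0 \<le> half_line_inv f y"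
  using inv_into_into[OF surj] by simp

lemma inv_mono:
  assumes "0 \<le> u" "u \<le> v"
  shows "half_line_inv f u \<le> half_line_inv f v"
proof (rule ccontr)
  assume less: "\<not> ?thesis"
  have "0 \<le> half_line_inv f u" "0 \<le> half_line_inv f v" using assms by (simp_all add: inv_nonneg)
  then have "f (half_line_inv f v) < f (half_line_inv f u)"
    using less by (intro strict_mono_onD[OF strict]) simp_all
  then show False using assms by (simp add: f_inv_into_f surj)
qed

text \<open>At \<open>m = 0\<close>, on the boundary of the domain, the horizontal line works.\<close>

lemma supporting_line:
  assumes "0 \<le> m"
  obtains k where "\<And>r. 0 \<le> r \<Longrightarrow> f m + k * (r - m) \<le> f r"
proof (cases "m = 0")
  case True
  then show thesis using nonneg by (intro that[of 0]) (simp add: zero)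
next
  case False
  then have "m \<in> interior {0..}" using assms by simp
  then show thesis using convex_le_Inf_differential[OF convex] by (intro that) auto
qed

section \<open>The operator Hermite-Hadamard inequality\<close>

text \<open>A supporting line of \<open>f\<close> at the midpoint \<open>m\<^sub>j\<close> of \<open>\<langle>A\<^sub>j x, x\<rangle>\<close> and \<open>\<langle>B\<^sub>j x, x\<rangle>\<close> bounds the
  form of \<open>f(t A\<^sub>j + (1 - t) B\<^sub>j)\<close> below by an affine function of \<open>t\<close>, whose integral
  over \<open>[0, 1]\<close> is its value \<open>f(m\<^sub>j)\<close> at \<open>t = 1 / 2\<close>.\<close>

lemma hermite_hadamard_form:
  fixes A B :: "'j \<Rightarrow> 'a::chilbert_space \<Rightarrow>\<^sub>L 'a"
  assumes A: "\<And>j. j \<in> J \<Longrightarrow> positive_op (A j)" and B: "\<And>j. j \<in> J \<Longrightarrow> positive_op (B j)"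
    and int: "(\<lambda>t. \<Sum>j\<in>J. op_fun f (t *\<^sub>R A j + (1 - t) *\<^sub>R B j)) integrable_on {0..1}"
    and x: "norm x = 1"
  shows "(\<Sum>j\<in>J. f ((Re (cinner (A j x) x) + Re (cinner (B j x) x)) / 2))
    \<le> Re (cinner (integral {0..1} (\<lambda>t. \<Sum>j\<in>J. op_fun f (t *\<^sub>R A j + (1 - t) *\<^sub>R B j)) x) x)"
proof -
  define a b where "a j = Re (cinner (A j x) x)" and "b j = Re (cinner (B j x) x)" for j
  define m where "m j = (a j + b j) / 2" for j
  have ab: "0 \<le> a j" "0 \<le> b j" if "j \<in> J" for j
    using A B that by (simp_all add: a_def b_def positive_opD)
  have "\<exists>k. \<forall>r\<ge>0. f (m j) + k * (r - m j) \<le> f r" if "j \<in> J" for j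
    using supporting_line[of "m j"] ab[OF that] by (auto simp: m_def)
  then obtain k where k: "\<And>j r. j \<in> J \<Longrightarrow> 0 \<le> r \<Longrightarrow> f (m j) + k j * (r - m j) \<le> f r" by metis
  define F where "F t = (\<Sum>j\<in>J. op_fun f (t *\<^sub>R A j + (1 - t) *\<^sub>R B j))" for t
  have "(\<Sum>j\<in>J. f (m j)) \<le> Re (cinner (integral {0..1} F x) x)"
  proof (rule has_integral_le)
    show "((\<lambda>t. Re (cinner (F t x) x)) has_integral Re (cinner (integral {0..1} F x) x)) {0..1}"
      using has_integral_linear[OF cinner_integral[OF int] bounded_linear_Re]
      by (simp add: o_def F_def[abs_def])
    define K where "K = (\<Sum>j\<in>J. k j * (a j - b j))"
    have "((\<lambda>t. (\<Sum>j\<in>J. f (m j)) + (t - 1 / 2) * K) has_integral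
        measure lborel {0..1::real} *\<^sub>R (\<Sum>j\<in>J. f (m j))
          + ((1\<^sup>2 - 0\<^sup>2) / 2 - measure lborel {0..1::real} *\<^sub>R (1 / 2)) * K) {0..1::real}"
      by (intro has_integral_add has_integral_mult_left has_integral_diff has_integral_const_real
          ident_has_integral) simp_all
    then show "((\<lambda>t. (\<Sum>j\<in>J. f (m j)) + (t - 1 / 2) * K) has_integral (\<Sum>j\<in>J. f (m j))) {0..1}"
      by simp
    fix t :: real assume t: "t \<in> {0..1}"
    have "f (m j) + (t - 1 / 2) * (k j * (a j - b j))
        \<le> Re (cinner (op_fun f (t *\<^sub>R A j + (1 - t) *\<^sub>R B j) x) x)" if j: "j \<in> J" for j
    proof -
      let ?C = "t *\<^sub>R A j + (1 - t) *\<^sub>R B j"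
      have "positive_op ?C"
        using t j by (intro positive_op_add positive_op_scaleR A B) simp_all
      then have "(f (m j) - k j * m j) * (norm x)\<^sup>2 + k j * Re (cinner (?C x) x)
          \<le> Re (cinner (op_fun f ?C x) x)"
        using k[OF j] by (intro op_fun_affine_minorant continuous) (auto simp: algebra_simps)
      moreover have "Re (cinner (?C x) x) = t * a j + (1 - t) * b j"
        by (simp add: blinfun.bilinear_simps cinner_simps a_def b_def)
      moreover have "f (m j) + (t - 1 / 2) * (k j * (a j - b j))
          = f (m j) - k j * m j + k j * (t * a j + (1 - t) * b j)"
        by (simp add: m_def field_simps)
      ultimately show ?thesis by (simp add: x)
    qed
    then have "(\<Sum>j\<in>J. f (m j) + (t - 1 / 2) * (k j * (a j - b j))) \<le> Re (cinner (F t x) x)"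
      by (simp add: F_def blinfun.sum_left linear_sum[OF bounded_linear.linear[OF bounded_linear_cinner_left]] sum_mono)
    then show "(\<Sum>j\<in>J. f (m j)) + (t - 1 / 2) * K \<le> Re (cinner (F t x) x)"
      by (simp add: K_def sum.distrib sum_distrib_left)
  qed
  then show ?thesis by (simp add: F_def[abs_def] m_def a_def b_def)
qed

end

lemma integral_operator_segment:
  fixes U V :: "'a::banach"
  shows "((\<lambda>t. t *\<^sub>R U + (1 - t) *\<^sub>R V) has_integral (1 / 2) *\<^sub>R (U + V)) {0..1::real}"
proof -
  have "((\<lambda>t. t *\<^sub>R U + (1 - t) *\<^sub>R V) has_integral
      ((1\<^sup>2 - 0\<^sup>2) / 2) *\<^sub>R U + (measure lborel {0..1::real} *\<^sub>R 1 - (1\<^sup>2 - 0\<^sup>2) / 2) *\<^sub>R V) {0..1::real}"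
    by (intro has_integral_add has_integral_scaleR_left has_integral_diff has_integral_const_real
        ident_has_integral) simp_all
  then show ?thesis by (simp add: scaleR_add_right)
qed

section \<open>The f-operator radius\<close>

theorem theorem3p2:
  fixes S T :: "nat \<Rightarrow> ('a::chilbert_space \<Rightarrow>\<^sub>L 'a)"
    and n :: nat
    and f :: "real \<Rightarrow> real"
  assumes "\<And>j. j \<in> {1..n} \<Longrightarrow> S j \<in> bounded_ops"
    and "\<And>j. j \<in> {1..n} \<Longrightarrow> T j \<in> bounded_ops"
    and "f \<in> {0..} \<rightarrow> {0..}"
    and "strict_mono_on {0..} f"
    and "operator_convex TYPE('a) f"
    and "f 0 = 0"
  shows "f_operator_radius f n (\<lambda>j. op_adj (T j) o\<^sub>L S j)
           \<le> half_line_inv f (norm (integral {0..1} (\<lambda>t. \<Sum>j=1..n.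
               op_fun f (t *\<^sub>R op_power (op_abs (S j)) 2
                         + (1 - t) *\<^sub>R op_power (op_abs (T j)) 2))))
       \<and> half_line_inv f (norm (integral {0..1} (\<lambda>t. \<Sum>j=1..n.
               op_fun f (t *\<^sub>R op_power (op_abs (S j)) 2
                         + (1 - t) *\<^sub>R op_power (op_abs (T j)) 2))))
           \<le> half_line_inv f (1 / 2 * norm (\<Sum>j=1..n.
               op_fun f (op_power (op_abs (S j)) 2) + op_fun f (op_power (op_abs (T j)) 2)))"
(* Convexity of f is available only on a nonzero space; on the zero space all three sides are 0. *)
proof (cases "\<exists>x0::'a. x0 \<noteq> 0")
  case False
  then have trivial: "B = 0" for B :: "'a \<Rightarrow>\<^sub>L 'a" by (intro blinfun_eqI) auto
  have "{x::'a. norm x = 1} = {}" using False by (metis (mono_tags, lifting) Collect_empty_eq norm_zero zero_neq_one)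
  moreover have "half_line_inv f 0 = 0"
    using inv_into_f_f[OF strict_mono_on_imp_inj_on[OF assms(4)], of 0] assms(6) by simp
  ultimately show ?thesis
    by (simp add: f_operator_radius_def trivial[of "integral _ _"] trivial[of "sum _ _"])
next
  case True
  then obtain x0 :: 'a where x0: "x0 \<noteq> 0" ..
  interpret half_line_gauge f
    using operator_convex_imp_convex_on[OF assms(5) x0] assms(4,6) by unfold_locales
  define A B where "A j = op_power (op_abs (S j)) 2" and "B j = op_power (op_abs (T j)) 2" for j
  have A_eq: "A j = op_adj (S j) o\<^sub>L S j" and B_eq: "B j = op_adj (T j) o\<^sub>L T j"
    if "j \<in> {1..n}" for j
    using that by (simp_all add: A_def B_def op_abs_squared assms(1,2))
  have A: "positive_op (A j)" and B: "positive_op (B j)" if "j \<in> {1..n}" for j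
    using that by (simp_all add: A_eq B_eq positive_op_adj_compose_self assms(1,2))
  define C where "C j t = t *\<^sub>R A j + (1 - t) *\<^sub>R B j" for j t
  have C: "positive_op (C j t)" if "j \<in> {1..n}" "t \<in> {0..1}" for j t
    unfolding C_def using that by (intro positive_op_add positive_op_scaleR A B) simp_all
  define F where "F t = (\<Sum>j=1..n. op_fun f (C j t))" for t
  have F_pos: "positive_op (F t)" if "t \<in> {0..1}" for t
    unfolding F_def using that by (intro positive_op_sum positive_op_fun C continuous nonneg)
  have "continuous_on {0..1} F"
    unfolding F_def C_def using C[unfolded C_def]
    by (intro continuous_on_sum continuous_on_op_fun continuous continuous_intros) simp_all
  then have F_int: "F integrable_on {0..1}" by (rule integrable_continuous_real)
  have int_pos: "positive_op (integral {0..1} F)"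
    using F_int F_pos by (rule positive_op_integral)

  have "f_operator_radius f n (\<lambda>j. op_adj (T j) o\<^sub>L S j) \<le> half_line_inv f (norm (integral {0..1} F))"
    unfolding f_operator_radius_def
  proof (rule cSup_least, simp, elim insertE imageE, simp add: inv_nonneg, clarsimp)
    fix x :: 'a assume x: "norm x = 1"
    let ?w = "\<lambda>j. cmod (cinner (op_adj (T j) (S j x)) x)"
    have "(\<Sum>j=1..n. f (?w j)) \<le> (\<Sum>j=1..n. f ((Re (cinner (A j x) x) + Re (cinner (B j x) x)) / 2))"
    proof (rule sum_mono)
      fix j assume j: "j \<in> {1..n}"
      have "?w j = cmod (cinner (S j x) (T j x))"
        using cinner_op_adj[OF assms(2)[OF j], of x "S j x"]
        by (metis cinner_commute complex_mod_cnj)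
      also have "\<dots> \<le> norm (S j x) * norm (T j x)" by (rule cmod_cinner_le)
      also have "\<dots> \<le> ((norm (S j x))\<^sup>2 + (norm (T j x))\<^sup>2) / 2"
        using sum_squares_bound[of "norm (S j x)" "norm (T j x)"] by simp
      also have "\<dots> = (Re (cinner (A j x) x) + Re (cinner (B j x) x)) / 2"
        using cinner_op_adj_compose_self assms(1,2) j A_eq B_eq
        by (metis Re_complex_of_real)
      finally show "f (?w j) \<le> f ((Re (cinner (A j x) x) + Re (cinner (B j x) x)) / 2)"
        by (intro mono) simp_all
    qed
    also have "\<dots> \<le> Re (cinner (integral {0..1} F x) x)"
      using hermite_hadamard_form[of "{1..n}" A B x] A B x F_int by (simp add: F_def[abs_def] C_def)
    also have "\<dots> \<le> norm (integral {0..1} F)"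
      using abs_Re_cinner_op_le[of "integral {0..1} F" x] x by simp
    finally show "half_line_inv f (\<Sum>j=Suc 0..n. f (?w j)) \<le> half_line_inv f (norm (integral {0..1} F))"
      by (intro inv_mono sum_nonneg nonneg) simp_all
  qed
  moreover
  (* Operator convexity puts the integrand below the segment from V to U. *)
  define U V where "U = (\<Sum>j=1..n. op_fun f (A j))" and "V = (\<Sum>j=1..n. op_fun f (B j))"
  have G_int: "((\<lambda>t. t *\<^sub>R U + (1 - t) *\<^sub>R V) has_integral (1 / 2) *\<^sub>R (U + V)) {0..1}"
    by (rule integral_operator_segment)
  have "op_le (integral {0..1} F) ((1 / 2) *\<^sub>R (U + V))"
  proof -
    have diff: "((\<lambda>t. t *\<^sub>R U + (1 - t) *\<^sub>R V - F t) has_integral (1 / 2) *\<^sub>R (U + V) - integral {0..1} F) {0..1}"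
      by (intro has_integral_diff G_int integrable_integral F_int)
    have "positive_op (t *\<^sub>R U + (1 - t) *\<^sub>R V - F t)" if t: "t \<in> {0..1}" for t
    proof -
      have "positive_op (t *\<^sub>R op_fun f (A j) + (1 - t) *\<^sub>R op_fun f (B j) - op_fun f (C j t))"
        if j: "j \<in> {1..n}" for j
        using assms(5) t A[OF j] B[OF j] unfolding operator_convex_def op_le_def C_def
        by (metis add.commute)
      then have "positive_op (\<Sum>j=1..n. t *\<^sub>R op_fun f (A j) + (1 - t) *\<^sub>R op_fun f (B j) - op_fun f (C j t))"
        by (rule positive_op_sum)
      then show ?thesis
        by (simp add: U_def V_def F_def sum.distrib sum_subtractf scaleR_sum_right)
    qed
    then have "positive_op (integral {0..1} (\<lambda>t. t *\<^sub>R U + (1 - t) *\<^sub>R V - F t))"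
      using diff by (intro positive_op_integral) auto
    then show ?thesis unfolding op_le_def integral_unique[OF diff] .
  qed
  then have "norm (integral {0..1} F) \<le> norm ((1 / 2) *\<^sub>R (U + V))"
    by (rule norm_op_mono[OF int_pos])
  then have "half_line_inv f (norm (integral {0..1} F)) \<le> half_line_inv f (1 / 2 * norm (U + V))"
    by (intro inv_mono) simp_all
  ultimately show ?thesis
    by (simp add: F_def[abs_def] C_def A_def B_def U_def V_def sum.distrib)
qed

end
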